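(* Let $G$ be an amenable (discrete) group. Then $G$ has Property (NL) if and only if every group homomorphism $G \to \mathbb{R} \rtimes \mathbb{Z}/2\mathbb{Z}$ has image of order at most $2$. In particular: (1) an abelian group has Property (NL) if and only if it is a torsion group; (2) a nilpotent group has Property (NL) if and only if every homomorphism from it to $\mathbb{R}$ is trivial.
   Context: A hyperbolic space is a geodesic metric space that is Gromov hyperbolic (not necessarily proper). Actions on hyperbolic spaces are by isometries. For an action of a group $G$ on a hyperbolic space $X$, an element $g\in G$ is loxodromic if $n\mapsto g^n x$, $n \in \mathbb{Z}$, is a quasi-isometric embedding $\mathbb{Z}\to X$ for some (equivalently any) $x\in X$. A group $G$ has Property (NL) if no isometric action of $G$ on a hyperbolic space admits a loxodromic element. A group is amenable if it carries a left-translation-invariant finitely additive probability measure. In $\mathbb{R}\rtimes\mathbb{Z}/2\mathbb{Z}$ the generator of $\mathbb{Z}/2\mathbb{Z}$ acts on $\mathbb{R}$ by $x\mapsto -x$, so that $\mathbb{R}\rtimes\mathbb{Z}/2\mathbb{Z}\cong \mathrm{Isom}(\mathbb{R})$. *)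

theory Defs
  imports "HOL-Analysis.Analysis" "HOL-Algebra.Group_Action" "HOL-Algebra.Elementary_Groups"
    "HOL-Algebra.Generated_Groups"
begin

definition geodesic_metric_space :: "'x metric \<Rightarrow> bool" where
  "geodesic_metric_space X \<longleftrightarrow>
     (\<forall>x\<in>mspace X. \<forall>y\<in>mspace X. \<exists>c :: real \<Rightarrow> 'x.
        c 0 = x \<and> c (mdist X x y) = y \<and>
        c ` {0..mdist X x y} \<subseteq> mspace X \<and>
        (\<forall>s\<in>{0..mdist X x y}. \<forall>t\<in>{0..mdist X x y}. mdist X (c s) (c t) = \<bar>s - t\<bar>))"

definition gromov_product :: "'x metric \<Rightarrow> 'x \<Rightarrow> 'x \<Rightarrow> 'x \<Rightarrow> real" where
  "gromov_product X w x y = (mdist X w x + mdist X w y - mdist X x y) / 2"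

definition gromov_hyperbolic :: "'x metric \<Rightarrow> bool" where
  "gromov_hyperbolic X \<longleftrightarrow>
     (\<exists>\<delta>\<ge>0. \<forall>w\<in>mspace X. \<forall>x\<in>mspace X. \<forall>y\<in>mspace X. \<forall>z\<in>mspace X.
        gromov_product X w x z \<ge> min (gromov_product X w x y) (gromov_product X w y z) - \<delta>)"

definition hyperbolic_space :: "'x metric \<Rightarrow> bool" where
  "hyperbolic_space X \<longleftrightarrow> geodesic_metric_space X \<and> gromov_hyperbolic X"

definition isometric_action ::
    "('g, 'm) monoid_scheme \<Rightarrow> 'x metric \<Rightarrow> ('g \<Rightarrow> 'x \<Rightarrow> 'x) \<Rightarrow> bool" where
  "isometric_action G X \<phi> \<longleftrightarrow>
     group_action G (mspace X) \<phi> \<and>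
     (\<forall>g\<in>carrier G. \<forall>x\<in>mspace X. \<forall>y\<in>mspace X. mdist X (\<phi> g x) (\<phi> g y) = mdist X x y)"

definition quasi_isometric_embedding :: "'x metric \<Rightarrow> 'y metric \<Rightarrow> ('x \<Rightarrow> 'y) \<Rightarrow> bool" where
  "quasi_isometric_embedding X Y f \<longleftrightarrow>
     f ` mspace X \<subseteq> mspace Y \<and>
     (\<exists>K\<ge>1. \<exists>C\<ge>0. \<forall>x\<in>mspace X. \<forall>y\<in>mspace X.
        mdist X x y / K - C \<le> mdist Y (f x) (f y) \<and>
        mdist Y (f x) (f y) \<le> K * mdist X x y + C)"

definition integer_metric :: "int metric" where
  "integer_metric = metric (UNIV, \<lambda>m n. \<bar>real_of_int m - real_of_int n\<bar>)"

lemma mspace_integer_metric [simp]: "mspace integer_metric = UNIV"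
  and mdist_integer_metric [simp]:
    "mdist integer_metric = (\<lambda>m n. \<bar>real_of_int m - real_of_int n\<bar>)"
proof -
  have "Metric_space UNIV (\<lambda>m n. \<bar>real_of_int m - real_of_int n\<bar>)"
    by unfold_locales auto
  then show "mspace integer_metric = UNIV"
    and "mdist integer_metric = (\<lambda>m n. \<bar>real_of_int m - real_of_int n\<bar>)"
    by (simp_all add: integer_metric_def Metric_space.mspace_metric Metric_space.mdist_metric)
qed

definition loxodromic ::
    "('g, 'm) monoid_scheme \<Rightarrow> 'x metric \<Rightarrow> ('g \<Rightarrow> 'x \<Rightarrow> 'x) \<Rightarrow> 'g \<Rightarrow> bool" where
  "loxodromic G X \<phi> g \<longleftrightarrow>
     (\<exists>x\<in>mspace X. quasi_isometric_embedding integer_metric X (\<lambda>n. \<phi> (g [^]\<^bsub>G\<^esub> n) x))"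

text \<open>HOL cannot quantify over all metric spaces, so the type \<open>'x\<close> from which the points of the
  spaces are drawn is a parameter. The unrelativised property is the conjunction of
  \<open>property_NL TYPE('x) G\<close> over all \<open>'x\<close>. The relative property only gets stronger when \<open>'x\<close> is
  replaced by a type into which it embeds.\<close>

definition property_NL :: "'x itself \<Rightarrow> ('g, 'm) monoid_scheme \<Rightarrow> bool" where
  "property_NL _ G \<longleftrightarrow>
     \<not> (\<exists>(X :: 'x metric) \<phi>. hyperbolic_space X \<and> isometric_action G X \<phi> \<and>
           (\<exists>g\<in>carrier G. loxodromic G X \<phi> g))"

definition amenable_group :: "('g, 'm) monoid_scheme \<Rightarrow> bool" where
  "amenable_group G \<longleftrightarrow> group G \<and>
     (\<exists>\<mu> :: 'g set \<Rightarrow> real.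
        (\<forall>A. A \<subseteq> carrier G \<longrightarrow> \<mu> A \<ge> 0) \<and>
        \<mu> (carrier G) = 1 \<and>
        (\<forall>A B. A \<subseteq> carrier G \<longrightarrow> B \<subseteq> carrier G \<longrightarrow> A \<inter> B = {} \<longrightarrow> \<mu> (A \<union> B) = \<mu> A + \<mu> B) \<and>
        (\<forall>g\<in>carrier G. \<forall>A. A \<subseteq> carrier G \<longrightarrow> \<mu> (g <#\<^bsub>G\<^esub> A) = \<mu> A))"

definition torsion_group :: "('g, 'm) monoid_scheme \<Rightarrow> bool" where
  "torsion_group G \<longleftrightarrow> group G \<and> (\<forall>g\<in>carrier G. \<exists>n::nat. n > 0 \<and> g [^]\<^bsub>G\<^esub> n = \<one>\<^bsub>G\<^esub>)"

primrec lower_central_series :: "('g, 'm) monoid_scheme \<Rightarrow> nat \<Rightarrow> 'g set" where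
  "lower_central_series G 0 = carrier G"
| "lower_central_series G (Suc n) =
     generate G (\<Union>x\<in>lower_central_series G n. \<Union>y\<in>carrier G.
       {x \<otimes>\<^bsub>G\<^esub> y \<otimes>\<^bsub>G\<^esub> inv\<^bsub>G\<^esub> x \<otimes>\<^bsub>G\<^esub> inv\<^bsub>G\<^esub> y})"

definition nilpotent_group :: "('g, 'm) monoid_scheme \<Rightarrow> bool" where
  "nilpotent_group G \<longleftrightarrow> group G \<and> (\<exists>n. lower_central_series G n = {\<one>\<^bsub>G\<^esub>})"

definition real_group :: "real monoid" where
  "real_group = \<lparr>carrier = UNIV, mult = (+), one = 0\<rparr>"

definition semidirect_product ::
    "('a, 'm) monoid_scheme \<Rightarrow> ('b, 'n) monoid_scheme \<Rightarrow> ('b \<Rightarrow> 'a \<Rightarrow> 'a) \<Rightarrow> ('a \<times> 'b) monoid" where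
  "semidirect_product N H \<theta> =
     \<lparr>carrier = carrier N \<times> carrier H,
      mult = (\<lambda>(n, h) (n', h'). (n \<otimes>\<^bsub>N\<^esub> \<theta> h n', h \<otimes>\<^bsub>H\<^esub> h')),
      one = (\<one>\<^bsub>N\<^esub>, \<one>\<^bsub>H\<^esub>)\<rparr>"

definition real_semidirect_Z2 :: "(real \<times> int) monoid" where
  "real_semidirect_Z2 =
     semidirect_product real_group (integer_mod_group 2) (\<lambda>k x. if k = 0 then x else - x)"

lemma group_real_group: "group real_group"
  by (rule groupI) (auto simp: real_group_def intro: exI[of _ "- x" for x :: real])

lemma carrier_real_semidirect_Z2: "carrier real_semidirect_Z2 = UNIV \<times> {0, 1}"
proof -
  have "{0..<2} = {0, 1 :: int}"
    by auto
  then show ?thesis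
    by (simp add: real_semidirect_Z2_def semidirect_product_def real_group_def
        carrier_integer_mod_group)
qed

lemma one_real_semidirect_Z2: "\<one>\<^bsub>real_semidirect_Z2\<^esub> = (0, 0)"
  by (simp add: real_semidirect_Z2_def semidirect_product_def real_group_def)

lemma mult_real_semidirect_Z2:
  "(a, k) \<otimes>\<^bsub>real_semidirect_Z2\<^esub> (b, l) = (if k = 0 then a + b else a - b, (k + l) mod 2)"
  by (simp add: real_semidirect_Z2_def semidirect_product_def real_group_def
      mult_integer_mod_group)

lemma group_real_semidirect_Z2: "group real_semidirect_Z2"
proof (rule groupI)
  fix x assume "x \<in> carrier real_semidirect_Z2"
  then obtain a k where x: "x = (a, k)" and k: "k = 0 \<or> k = 1"
    by (auto simp: carrier_real_semidirect_Z2)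
  show "\<exists>y\<in>carrier real_semidirect_Z2. y \<otimes>\<^bsub>real_semidirect_Z2\<^esub> x = \<one>\<^bsub>real_semidirect_Z2\<^esub>"
    using k by (intro bexI[of _ "(if k = 0 then - a else a, k)"])
      (auto simp: x carrier_real_semidirect_Z2 one_real_semidirect_Z2 mult_real_semidirect_Z2)
qed (auto simp: carrier_real_semidirect_Z2 one_real_semidirect_Z2 mult_real_semidirect_Z2)

end

theory Submission
  imports Defs "HOL-Real_Asymp.Real_Asymp"
begin

text \<open>
  An isometric action of \<open>G\<close> with a base point \<open>x\<close> is recorded by the left-invariant pseudometric
  \<open>\<rho>(g, h) = d(g x, h x)\<close> on \<open>G\<close>, which inherits the four-point condition of hyperbolicity. Suppose
  that \<open>G\<close> has an invariant mean and that some element is loxodromic. A suitable power \<open>\<gamma>\<close> of it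
  satisfies \<open>\<rho>(1, \<gamma>\<^sup>2) \<ge> \<rho>(1, \<gamma>) + 3\<delta> + 1\<close> (\<open>exists_doubling_step\<close>). Consider the distance
  from \<open>s \<in> G\<close> to \<open>\<gamma>\<^sup>n\<close> as a function of \<open>n\<close>. Hyperbolicity excludes local maxima, and invariance of
  the mean shows that local minima occur only on a null set (\<open>measure_ascends_descends\<close>). Almost
  every \<open>s\<close> therefore lies towards one of the two ends of the axis of \<open>\<gamma>\<close>. Two such points lie towards
  the same end if and only if their Gromov product is large, a criterion that survives a change of
  base point; so every \<open>h \<in> G\<close> fixes or exchanges the ends, up to null sets
  (\<open>side_relation_invariant\<close>). This defines a sign \<open>orientation h\<close>.

  Let \<open>side s = \<plusminus>1\<close> record the end of \<open>s\<close>, and let \<open>drift h\<close> be the mean over \<open>s\<close> of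
  \<open>side s * (\<rho>(h, s) - \<rho>(1, s))\<close>. Invariance of the mean turns this averaged Busemann function into an
  exact cocycle, \<open>drift (h k) = drift h + orientation h * drift k\<close> (\<open>drift_mult\<close>). Thus
  \<open>h \<mapsto> (drift h, orientation h)\<close> is a homomorphism to \<open>\<real> \<rtimes> \<int>/2\<int>\<close>. It maps \<open>\<gamma>\<close> to a nontrivial
  translation, hence its image is infinite.

  Conversely, a homomorphism to \<open>\<real> \<rtimes> \<int>/2\<int>\<close> whose image has more than two elements has a nontrivial
  translation in its image, and the element mapped to it is loxodromic for the corresponding action
  on a copy of the line.

  For abelian and nilpotent groups it suffices that torsion groups have no loxodromic elements. An
  element of infinite order in an abelian group is detected by a homomorphism to the divisible group
  \<open>\<real>\<close> (\<open>exists_real_hom_if_infinite_order\<close>), and such a homomorphism yields a translation action. A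
  nilpotent group without nontrivial homomorphisms to \<open>\<real>\<close> has torsion abelianization, and torsion then
  propagates down the lower central series (\<open>lower_central_quotient_torsion\<close>).
\<close>

section \<open>Finitely additive probabilities and their integral\<close>

lemma eq_if_near:
  fixes a b :: real
  assumes "\<And>e. e > 0 \<Longrightarrow> \<bar>a - b\<bar> \<le> C * e" "C > 0"
  shows "a = b"
proof (rule ccontr)
  assume "a \<noteq> b"
  then have "\<bar>a - b\<bar> / (2 * C) > 0"
    using assms(2) by simp
  from assms(1)[OF this] show False
    using \<open>a \<noteq> b\<close> assms(2) by (simp add: field_simps)
qed

locale finitely_additive_probability =
  fixes m :: "'a set \<Rightarrow> real"
  assumes nonneg: "0 \<le> m A"
    and total: "m UNIV = 1"
    and additive: "A \<inter> B = {} \<Longrightarrow> m (A \<union> B) = m A + m B"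
begin

lemma empty [simp]: "m {} = 0"
  using additive[of "{}" "{}"] by simp

lemma mono: "A \<subseteq> B \<Longrightarrow> m A \<le> m B"
  using additive[of A "B - A"] nonneg[of "B - A"] by (simp add: Un_absorb1)

lemma compl: "m (- A) = 1 - m A"
  using additive[of A "- A"] total by (simp add: Compl_partition)

lemma null_Un: "m A = 0 \<Longrightarrow> m B = 0 \<Longrightarrow> m (A \<union> B) = 0"
  using additive[of A "B - A"] mono[of "B - A" B] nonneg[of "B - A"] by simp

lemma null_subset: "A \<subseteq> B \<Longrightarrow> m B = 0 \<Longrightarrow> m A = 0"
  using mono[of A B] nonneg[of A] by simp

lemma sum_Union:
  assumes "finite I" "\<And>i j. i \<in> I \<Longrightarrow> j \<in> I \<Longrightarrow> i \<noteq> j \<Longrightarrow> A i \<inter> A j = {}"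
  shows "m (\<Union>i\<in>I. A i) = (\<Sum>i\<in>I. m (A i))"
  using assms
proof (induction I rule: finite_induct)
  case (insert i I)
  have "A i \<inter> (\<Union>j\<in>I. A j) = {}"
    using insert.prems insert.hyps by blast
  then show ?case
    using insert by (simp add: additive)
qed simp

text \<open>The events of probability one are closed under finite intersections and supersets, so they form
  a filter, and ``almost every'' becomes \<^term>\<open>eventually\<close>. Without countable additivity, only
  finitely many almost sure properties may be combined.\<close>

definition almost_all :: "'a filter" where
  "almost_all = Abs_filter (\<lambda>P. m {x. \<not> P x} = 0)"

lemma eventually_almost_all: "eventually P almost_all \<longleftrightarrow> m {x. \<not> P x} = 0"
  unfolding almost_all_def
proof (rule eventually_Abs_filter, rule is_filter.intro)
  fix P Q :: "'a \<Rightarrow> bool"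
  assume "m {x. \<not> P x} = 0" "m {x. \<not> Q x} = 0"
  then have "m ({x. \<not> P x} \<union> {x. \<not> Q x}) = 0"
    by (rule null_Un)
  then show "m {x. \<not> (P x \<and> Q x)} = 0"
    by (rule null_subset[rotated]) auto
next
  fix P Q :: "'a \<Rightarrow> bool"
  assume "\<forall>x. P x \<longrightarrow> Q x" "m {x. \<not> P x} = 0"
  then show "m {x. \<not> Q x} = 0"
    by (intro null_subset[of "{x. \<not> Q x}" "{x. \<not> P x}"]) auto
qed simp

lemma almost_all_neq_bot: "almost_all \<noteq> bot"
  by (simp add: trivial_limit_def eventually_almost_all total)

definition simple :: "('a \<Rightarrow> real) \<Rightarrow> bool" where
  "simple u \<longleftrightarrow> finite (range u)"

definition simple_integral :: "('a \<Rightarrow> real) \<Rightarrow> real" where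
  "simple_integral u = (\<Sum>c\<in>range u. c * m (u -` {c}))"

text \<open>Two simple functions are compared on a common finite partition: both factor through the map
  \<^term>\<open>p\<close> to the pair of their values, and the sum may be taken over the fibres of \<^term>\<open>p\<close>.\<close>

lemma simple_integral_compose:
  fixes p :: "'a \<Rightarrow> 'b" and u :: "'b \<Rightarrow> real"
  assumes "finite (range p)"
  shows "simple_integral (\<lambda>x. u (p x)) = (\<Sum>b\<in>range p. u b * m (p -` {b}))"
proof -
  have fib: "m ((\<lambda>x. u (p x)) -` {c}) = (\<Sum>b\<in>{b\<in>range p. u b = c}. m (p -` {b}))" for c
  proof -
    have "(\<lambda>x. u (p x)) -` {c} = (\<Union>b\<in>{b\<in>range p. u b = c}. p -` {b})"
      by auto
    then show ?thesis
      using assms by (subst sum_Union[symmetric]) auto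
  qed
  have "range (\<lambda>x. u (p x)) = u ` range p"
    by auto
  then have "simple_integral (\<lambda>x. u (p x)) =
      (\<Sum>c\<in>u ` range p. \<Sum>b\<in>{b\<in>range p. u b = c}. u b * m (p -` {b}))"
    unfolding simple_integral_def by (simp add: fib sum_distrib_left cong: sum.cong_simp)
  also have "\<dots> = (\<Sum>b\<in>range p. u b * m (p -` {b}))"
    using assms by (rule sum.image_gen[symmetric])
  finally show ?thesis .
qed

lemma
  assumes "simple u" "simple v"
  shows simple_add: "simple (\<lambda>x. u x + v x)"
    and simple_integral_add:
      "simple_integral (\<lambda>x. u x + v x) = simple_integral u + simple_integral v"
    and simple_integral_mono_AE:
      "eventually (\<lambda>x. u x \<le> v x) almost_all \<Longrightarrow> simple_integral u \<le> simple_integral v"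
proof -
  define p where "p x = (u x, v x)" for x
  have "range p \<subseteq> range u \<times> range v"
    by (auto simp: p_def)
  then have fin: "finite (range p)"
    using assms by (meson finite_SigmaI finite_subset simple_def)
  have "range (\<lambda>x. u x + v x) = (\<lambda>b. fst b + snd b) ` range p"
    by (auto simp: p_def image_image)
  then show "simple (\<lambda>x. u x + v x)"
    using fin by (simp add: simple_def)
  have sum: "simple_integral (\<lambda>x. w (p x)) = (\<Sum>b\<in>range p. w b * m (p -` {b}))"
    for w :: "real \<times> real \<Rightarrow> real"
    by (rule simple_integral_compose[OF fin])
  have eqs: "(\<lambda>x. u x + v x) = (\<lambda>x. fst (p x) + snd (p x))" "u = (\<lambda>x. fst (p x))" "v = (\<lambda>x. snd (p x))"
    by (auto simp: p_def)
  show "simple_integral (\<lambda>x. u x + v x) = simple_integral u + simple_integral v"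
    by (subst eqs(1), subst eqs(2), subst eqs(3))
      (use sum[of "\<lambda>b. fst b + snd b"] sum[of fst] sum[of snd] in
        \<open>simp add: sum.distrib distrib_right\<close>)
  assume le: "eventually (\<lambda>x. u x \<le> v x) almost_all"
  have "fst b * m (p -` {b}) \<le> snd b * m (p -` {b})" for b
  proof (cases "fst b \<le> snd b")
    case True
    then show ?thesis
      using nonneg by (intro mult_right_mono) auto
  next
    case False
    then have "m (p -` {b}) = 0"
      using le unfolding eventually_almost_all
      by (intro null_subset[of "p -` {b}" "{x. \<not> u x \<le> v x}"]) (auto simp: p_def)
    then show ?thesis by simp
  qed
  then show "simple_integral u \<le> simple_integral v"
    by (subst eqs(2), subst eqs(3)) (use sum[of fst] sum[of snd] in \<open>simp add: sum_mono\<close>)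
qed

lemma simple_const [simp]: "simple (\<lambda>x. c)"
  by (simp add: simple_def)

lemma simple_integral_const [simp]: "simple_integral (\<lambda>x. c) = c"
  by (simp add: simple_integral_def total)

text \<open>The upper integral. On bounded functions it agrees with the lower one, since these are uniform
  limits of simple functions; this is why it is additive.\<close>

definition integral :: "('a \<Rightarrow> real) \<Rightarrow> real" where
  "integral f = Inf {simple_integral u | u. simple u \<and> (\<forall>x. f x \<le> u x)}"

lemma exists_simple_approximation:
  assumes "\<And>x. \<bar>f x\<bar> \<le> B" "e > 0"
  obtains u where "simple u" "\<And>x. \<bar>f x - u x\<bar> \<le> e"
proof
  let ?u = "\<lambda>x. e * \<lfloor>f x / e\<rfloor>"
  have "range (\<lambda>x. \<lfloor>f x / e\<rfloor>) \<subseteq> {\<lfloor>- B / e\<rfloor>..\<lfloor>B / e\<rfloor>}"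
  proof safe
    fix x
    have "- B \<le> f x" "f x \<le> B"
      using assms(1)[of x] by (auto simp: abs_le_iff)
    then have "- B / e \<le> f x / e" "f x / e \<le> B / e"
      using assms(2) by (simp_all only: divide_right_mono order_less_imp_le)
    then show "\<lfloor>f x / e\<rfloor> \<in> {\<lfloor>- B / e\<rfloor>..\<lfloor>B / e\<rfloor>}"
      by (auto intro: floor_mono)
  qed
  then have "finite (range (\<lambda>x. \<lfloor>f x / e\<rfloor>))"
    by (rule finite_subset) simp
  then have "finite ((\<lambda>k. e * of_int k) ` range (\<lambda>x. \<lfloor>f x / e\<rfloor>))"
    by simp
  then show "simple ?u"
    by (simp add: simple_def image_image)
  fix x
  have "of_int \<lfloor>f x / e\<rfloor> \<le> f x / e" "f x / e \<le> of_int \<lfloor>f x / e\<rfloor> + 1"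
    by linarith+
  then have "?u x \<le> f x" "f x \<le> ?u x + e"
    using assms(2) by (simp_all only: pos_le_divide_eq pos_divide_le_eq distrib_left mult.commute mult_1_right)
  then show "\<bar>f x - ?u x\<bar> \<le> e"
    by linarith
qed

text \<open>All properties of the integral are transferred from simple functions through this estimate.\<close>

lemma integral_near_simple_integral:
  assumes "simple u" "eventually (\<lambda>x. \<bar>f x - u x\<bar> \<le> e) almost_all" "\<And>x. \<bar>f x\<bar> \<le> B"
  shows "\<bar>integral f - simple_integral u\<bar> \<le> e"
proof -
  let ?S = "{simple_integral u | u. simple u \<and> (\<forall>x. f x \<le> u x)}"
  have shift: "simple (\<lambda>x. v x + c)" "simple_integral (\<lambda>x. v x + c) = simple_integral v + c"
    if "simple v" for v c
    using simple_add[OF that simple_const] simple_integral_add[OF that simple_const] by auto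
  have low: "simple_integral u - e \<le> y" if y: "y \<in> ?S" for y
  proof -
    obtain v where v: "y = simple_integral v" "simple v" "\<forall>x. f x \<le> v x"
      using y by blast
    have "eventually (\<lambda>x. u x + (- e) \<le> v x) almost_all"
      using assms(2)
    proof eventually_elim
      case (elim x)
      then show ?case using v(3)[rule_format, of x] by linarith
    qed
    then have "simple_integral (\<lambda>x. u x + (- e)) \<le> simple_integral v"
      by (rule simple_integral_mono_AE[OF shift(1)[OF assms(1)] v(2)])
    then show ?thesis
      using shift(2)[OF assms(1), of "- e"] v by simp
  qed
  have bdd: "bdd_below ?S"
    using low by (meson bdd_belowI)
  have ne: "?S \<noteq> {}"
    using assms(3) simple_const[of B] by (auto intro!: exI[of _ "\<lambda>x. B"] dest: abs_le_D1)
  have "simple_integral u - e \<le> integral f"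
    unfolding integral_def by (rule cInf_greatest[OF ne low])
  moreover have "integral f \<le> simple_integral u + e + d" if "d > 0" for d
  proof -
    obtain w where w: "simple w" "\<And>x. \<bar>f x - w x\<bar> \<le> d / 2"
      using exists_simple_approximation[of f B "d / 2", OF assms(3)] \<open>d > 0\<close> half_gt_zero by blast
    have "integral f \<le> simple_integral (\<lambda>x. w x + d / 2)"
      unfolding integral_def
    proof (rule cInf_lower[OF _ bdd])
      have "f x \<le> w x + d / 2" for x
        using w(2)[of x] by linarith
      then show "simple_integral (\<lambda>x. w x + d / 2) \<in> ?S"
        using shift(1)[OF w(1)] by blast
    qed
    also have "\<dots> \<le> simple_integral (\<lambda>x. (u x + e) + d)"
    proof (rule simple_integral_mono_AE)
      show "eventually (\<lambda>x. w x + d / 2 \<le> u x + e + d) almost_all"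
        using assms(2)
      proof eventually_elim
        case (elim x)
        then show ?case using w(2)[of x] by linarith
      qed
    qed (use shift(1) w(1) assms(1) in auto)
    also have "\<dots> = simple_integral u + e + d"
      using shift[OF shift(1)[OF assms(1)]] shift[OF assms(1)] by simp
    finally show ?thesis .
  qed
  then have "integral f \<le> simple_integral u + e"
    by (rule field_le_epsilon)
  ultimately show ?thesis
    by linarith
qed

lemma integral_add:
  assumes f: "\<And>x. \<bar>f x\<bar> \<le> B" and g: "\<And>x. \<bar>g x\<bar> \<le> C"
  shows "integral (\<lambda>x. f x + g x) = integral f + integral g"
proof (rule eq_if_near[of _ _ 4])
  fix e :: real assume e: "e > 0"
  obtain u where u: "simple u" "\<And>x. \<bar>f x - u x\<bar> \<le> e"
    using exists_simple_approximation[of f B e] f e by blast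
  obtain v where v: "simple v" "\<And>x. \<bar>g x - v x\<bar> \<le> e"
    using exists_simple_approximation[of g C e] g e by blast
  have "\<bar>f x + g x - (u x + v x)\<bar> \<le> 2 * e" for x
    using u(2)[of x] v(2)[of x] by linarith
  moreover have "\<bar>f x + g x\<bar> \<le> B + C" for x
    using f[of x] g[of x] by linarith
  ultimately have "\<bar>integral (\<lambda>x. f x + g x) - simple_integral (\<lambda>x. u x + v x)\<bar> \<le> 2 * e"
    by (intro integral_near_simple_integral simple_add u v always_eventually) auto
  moreover have "\<bar>integral f - simple_integral u\<bar> \<le> e"
    by (rule integral_near_simple_integral[OF u(1) always_eventually f]) (use u(2) in blast)
  moreover have "\<bar>integral g - simple_integral v\<bar> \<le> e"
    by (rule integral_near_simple_integral[OF v(1) always_eventually g]) (use v(2) in blast)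
  ultimately show "\<bar>integral (\<lambda>x. f x + g x) - (integral f + integral g)\<bar> \<le> 4 * e"
    using simple_integral_add[OF u(1) v(1)] by linarith
qed simp

lemma integral_const: "integral (\<lambda>x. c) = c"
  using integral_near_simple_integral[of "\<lambda>x. c" "\<lambda>x. c" 0 "\<bar>c\<bar>"] by simp

lemma integral_minus:
  assumes "\<And>x. \<bar>f x\<bar> \<le> B"
  shows "integral (\<lambda>x. - f x) = - integral f"
  using integral_add[of f B "\<lambda>x. - f x" B] assms integral_const[of 0] by simp

lemma integral_mono_AE:
  assumes le: "eventually (\<lambda>x. f x \<le> g x) almost_all"
    and f: "\<And>x. \<bar>f x\<bar> \<le> B" and g: "\<And>x. \<bar>g x\<bar> \<le> C"
  shows "integral f \<le> integral g"
proof (rule field_le_epsilon)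
  fix e :: real assume e: "e > 0"
  obtain u where u: "simple u" "\<And>x. \<bar>f x - u x\<bar> \<le> e / 4"
    using exists_simple_approximation[of f B "e / 4"] f e by auto
  obtain v where v: "simple v" "\<And>x. \<bar>g x - v x\<bar> \<le> e / 4"
    using exists_simple_approximation[of g C "e / 4"] g e by auto
  have "simple_integral u \<le> simple_integral (\<lambda>x. v x + e / 2)"
  proof (rule simple_integral_mono_AE[OF u(1) simple_add[OF v(1) simple_const]])
    show "eventually (\<lambda>x. u x \<le> v x + e / 2) almost_all"
      using le
    proof eventually_elim
      case (elim x)
      then show ?case using u(2)[of x] v(2)[of x] by linarith
    qed
  qed
  also have "\<dots> = simple_integral v + e / 2"
    using simple_integral_add[OF v(1) simple_const] by simp
  moreover have "\<bar>integral f - simple_integral u\<bar> \<le> e / 4"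
    by (rule integral_near_simple_integral[OF u(1) always_eventually f]) (use u(2) in blast)
  moreover have "\<bar>integral g - simple_integral v\<bar> \<le> e / 4"
    by (rule integral_near_simple_integral[OF v(1) always_eventually g]) (use v(2) in blast)
  ultimately show "integral f \<le> integral g + e"
    by linarith
qed

lemma integral_cong_AE:
  assumes "eventually (\<lambda>x. f x = g x) almost_all"
    and "\<And>x. \<bar>f x\<bar> \<le> B" "\<And>x. \<bar>g x\<bar> \<le> C"
  shows "integral f = integral g"
proof (rule antisym)
  show "integral f \<le> integral g"
    by (rule integral_mono_AE[OF eventually_mono[OF assms(1)] assms(2,3)]) simp
  show "integral g \<le> integral f"
    by (rule integral_mono_AE[OF eventually_mono[OF assms(1)] assms(3,2)]) simp
qed

lemma integral_measure_preserving:
  assumes T: "\<And>A. m (T -` A) = m A" and f: "\<And>x. \<bar>f x\<bar> \<le> B"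
  shows "integral (\<lambda>x. f (T x)) = integral f"
proof (rule eq_if_near[of _ _ 2])
  fix e :: real assume e: "e > 0"
  obtain u where u: "simple u" "\<And>x. \<bar>f x - u x\<bar> \<le> e"
    using exists_simple_approximation[of f B e] f e by blast
  have "simple_integral (\<lambda>x. u (T x)) = simple_integral u"
  proof -
    have sub: "range (\<lambda>x. u (T x)) \<subseteq> range u" by auto
    have "simple_integral (\<lambda>x. u (T x)) = (\<Sum>c\<in>range (\<lambda>x. u (T x)). c * m (u -` {c}))"
      proof -
      have "m ((\<lambda>x. u (T x)) -` {c}) = m (u -` {c})" for c
        using T[of "u -` {c}"] by (simp add: vimage_def)
      then show ?thesis by (simp add: simple_integral_def)
    qed
    also have "\<dots> = (\<Sum>c\<in>range u. c * m (u -` {c}))"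
    proof (rule sum.mono_neutral_left)
      show "\<forall>c\<in>range u - range (\<lambda>x. u (T x)). c * m (u -` {c}) = 0"
      proof
        fix c assume "c \<in> range u - range (\<lambda>x. u (T x))"
        then have "T -` (u -` {c}) = {}" by (auto simp del: vimage_singleton_eq) (metis rangeI vimage_singleton_eq)
        then show "c * m (u -` {c}) = 0"
          using T[of "u -` {c}"] by simp
      qed
    qed (use u(1) sub in \<open>auto simp: simple_def\<close>)
    finally show ?thesis by (simp add: simple_integral_def)
  qed
  moreover have "simple (\<lambda>x. u (T x))"
    using u(1) unfolding simple_def by (rule rev_finite_subset) auto
  then have "\<bar>integral (\<lambda>x. f (T x)) - simple_integral (\<lambda>x. u (T x))\<bar> \<le> e"
    by (rule integral_near_simple_integral) (use u f in auto)
  moreover have "\<bar>integral f - simple_integral u\<bar> \<le> e"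
    by (rule integral_near_simple_integral[OF u(1) always_eventually f]) (use u(2) in blast)
  ultimately show "\<bar>integral (\<lambda>x. f (T x)) - integral f\<bar> \<le> 2 * e"
    by linarith
qed simp

end

section \<open>Amenable groups with a hyperbolic left-invariant pseudometric\<close>

text \<open>A mean on the subsets of \<^term>\<open>carrier G\<close> is extended to all sets of the type by intersecting
  with the carrier, so that preimages under translations need no side condition.\<close>

locale left_invariant_mean = group G + finitely_additive_probability m
  for G :: "('g, 'm) monoid_scheme" (structure) and m :: "'g set \<Rightarrow> real" +
  assumes concentrated: "m (carrier G) = 1"
    and left_invariant: "h \<in> carrier G \<Longrightarrow> m ((\<lambda>s. h \<otimes> s) -` A) = m A"
begin

lemma almost_all_carrier: "eventually (\<lambda>s. s \<in> carrier G) almost_all"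
proof -
  have "{s. s \<notin> carrier G} = - carrier G"
    by auto
  then show ?thesis
    using compl[of "carrier G"] concentrated by (simp add: eventually_almost_all)
qed

lemma measure_cong_carrier:
  assumes "\<And>s. s \<in> carrier G \<Longrightarrow> s \<in> A \<longleftrightarrow> s \<in> B"
  shows "m A = m B"
proof -
  have null: "m (D - carrier G) = 0" for D
    using almost_all_carrier unfolding eventually_almost_all
    by (rule null_subset[rotated]) auto
  have "m D = m (D \<inter> carrier G)" for D
    using additive[of "D \<inter> carrier G" "D - carrier G"] null[of D] by (simp add: Int_Diff_Un Int_Diff_disjoint)
  moreover have "A \<inter> carrier G = B \<inter> carrier G"
    using assms by auto
  ultimately show ?thesis
    by metis
qed

lemma almost_all_translate:
  assumes "eventually P almost_all" "h \<in> carrier G"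
  shows "eventually (\<lambda>s. P (h \<otimes> s)) almost_all"
  using assms left_invariant[of h "{s. \<not> P s}"] by (simp add: eventually_almost_all)

text \<open>Since \<open>m (A \<union> B) + m (A \<inter> B) = m A + m B = 1\<close>, each of ``disjoint'' and ``covering'' forces the
  other up to a null set.\<close>

lemma almost_all_complementary:
  assumes "m A + m B = 1"
    and "A \<inter> B = {} \<or> carrier G \<subseteq> A \<union> B"
  shows "eventually (\<lambda>s. s \<in> B \<longleftrightarrow> s \<notin> A) almost_all"
proof -
  have "m (A \<union> B) + m (A \<inter> B) = m A + m B"
  proof -
    have "(A \<inter> B) \<union> (B - A) = B"
      by auto
    then show ?thesis
      using additive[of A "B - A"] additive[of "A \<inter> B" "B - A"] by force
  qed
  moreover have "m (A \<union> B) = 1" if "carrier G \<subseteq> A \<union> B"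
    using mono[OF that] concentrated mono[of "A \<union> B" UNIV] total by simp
  ultimately have "m (A \<inter> B) = 0" "m (- (A \<union> B)) = 0"
    using assms compl[of "A \<union> B"] by auto
  then have "m ((A \<inter> B) \<union> (- (A \<union> B))) = 0"
    by (rule null_Un)
  then show ?thesis
    unfolding eventually_almost_all by (rule null_subset[rotated]) auto
qed

end

locale left_invariant_pseudometric = group G
  for G :: "('g, 'm) monoid_scheme" (structure) +
  fixes \<rho> :: "'g \<Rightarrow> 'g \<Rightarrow> real"
  assumes dist_refl: "x \<in> carrier G \<Longrightarrow> \<rho> x x = 0"
    and dist_nonneg: "0 \<le> \<rho> x y"
    and dist_sym: "\<rho> x y = \<rho> y x"
    and dist_triangle: "x \<in> carrier G \<Longrightarrow> y \<in> carrier G \<Longrightarrow> z \<in> carrier G \<Longrightarrow> \<rho> x z \<le> \<rho> x y + \<rho> y z"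
    and dist_translate: "h \<in> carrier G \<Longrightarrow> x \<in> carrier G \<Longrightarrow> y \<in> carrier G \<Longrightarrow> \<rho> (h \<otimes> x) (h \<otimes> y) = \<rho> x y"

text \<open>The element \<open>\<gamma>\<close> plays the role of a loxodromic. Hyperbolicity enters in the four-point form, and
  the powers \<open>\<gamma>\<^sup>n\<close> serve as an axis. The gap \<open>3\<delta> + 1\<close> is chosen so that, after the loss of \<open>2\<delta>\<close>
  in the four-point condition, distances to the axis still change by \<open>\<delta> + 1\<close> per step.\<close>

locale amenable_hyperbolic_group =
  left_invariant_mean G m + left_invariant_pseudometric G \<rho>
  for G :: "('g, 'm) monoid_scheme" (structure) and m and \<rho> :: "'g \<Rightarrow> 'g \<Rightarrow> real" +
  fixes \<delta> :: real and \<gamma> :: 'g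
  assumes delta_nonneg: "0 \<le> \<delta>"
    and four_point: "x \<in> carrier G \<Longrightarrow> y \<in> carrier G \<Longrightarrow> z \<in> carrier G \<Longrightarrow> w \<in> carrier G \<Longrightarrow>
      \<rho> x z + \<rho> y w \<le> max (\<rho> x y + \<rho> z w) (\<rho> x w + \<rho> y z) + 2 * \<delta>"
    and gamma [simp]: "\<gamma> \<in> carrier G"
    and stretch: "\<rho> \<one> \<gamma> + 3 * \<delta> + 1 \<le> \<rho> \<one> (\<gamma> [^] (2::int))"
begin

definition axis_dist :: "'g \<Rightarrow> int \<Rightarrow> real" where
  "axis_dist s n = \<rho> s (\<gamma> [^] n)"

text \<open>A point at the negative end of the axis sees its distance to \<open>\<gamma>\<^sup>n\<close> increase with \<open>n\<close>, a point at
  the positive end sees it decrease. At a point projecting to \<open>\<gamma>\<^sup>n\<close> both \<open>ascends n\<close> and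
  \<open>descends n\<close> hold.\<close>

definition ascends :: "int \<Rightarrow> 'g \<Rightarrow> bool" where
  "ascends n s \<longleftrightarrow> axis_dist s n < axis_dist s (n + 1)"

definition descends :: "int \<Rightarrow> 'g \<Rightarrow> bool" where
  "descends n s \<longleftrightarrow> axis_dist s n < axis_dist s (n - 1)"

lemma dist_powers: "\<rho> (\<gamma> [^] (i::int)) (\<gamma> [^] j) = \<rho> \<one> (\<gamma> [^] (j - i))"
proof -
  have "\<gamma> [^] j = \<gamma> [^] i \<otimes> \<gamma> [^] (j - i)"
    using int_pow_mult[of \<gamma> i "j - i"] by simp
  then show ?thesis
    using dist_translate[of "\<gamma> [^] i" \<one> "\<gamma> [^] (j - i)"] by simp
qed

lemma dist_powers_Suc: "\<rho> (\<gamma> [^] (i::int)) (\<gamma> [^] (i + 1)) = \<rho> \<one> \<gamma>"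
  by (simp add: dist_powers)

lemma axis_dist_translate:
  assumes "s \<in> carrier G"
  shows "axis_dist (\<gamma> \<otimes> s) (n + 1) = axis_dist s n"
proof -
  have "\<gamma> [^] (n + 1) = \<gamma> \<otimes> \<gamma> [^] n"
    using int_pow_mult[of \<gamma> 1 n] by (simp add: add.commute)
  then show ?thesis
    using assms by (simp add: axis_dist_def dist_translate)
qed

text \<open>The four-point condition for \<open>s\<close>, \<open>\<gamma>\<^sup>n\<^sup>-\<^sup>1\<close>, \<open>\<gamma>\<^sup>n\<close>, \<open>\<gamma>\<^sup>n\<^sup>+\<^sup>1\<close> and the stretching of \<open>\<gamma>\<close>: the distance
  to the axis has no local maximum, and leaves each point at a definite speed on at least one side.\<close>

lemma quasi_convex:
  assumes "s \<in> carrier G"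
  shows "axis_dist s n + (\<delta> + 1) \<le> max (axis_dist s (n - 1)) (axis_dist s (n + 1))"
proof -
  let ?g = "\<lambda>k::int. \<gamma> [^] k"
  have "\<rho> s (?g n) + \<rho> (?g (n - 1)) (?g (n + 1))
      \<le> max (\<rho> s (?g (n - 1)) + \<rho> (?g n) (?g (n + 1))) (\<rho> s (?g (n + 1)) + \<rho> (?g (n - 1)) (?g n)) + 2 * \<delta>"
    using assms by (intro four_point) auto
  moreover have "\<rho> (?g (n - 1)) (?g n) = \<rho> \<one> \<gamma>"
    using dist_powers_Suc[of "n - 1"] by simp
  moreover have "\<rho> (?g (n - 1)) (?g (n + 1)) = \<rho> \<one> (?g 2)"
    by (simp add: dist_powers)
  ultimately show ?thesis
    using stretch dist_powers_Suc[of n] unfolding axis_dist_def by linarith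
qed

lemma ascends_or_descends: "s \<in> carrier G \<Longrightarrow> \<not> ascends n s \<Longrightarrow> descends n s"
  using quasi_convex[of s n] delta_nonneg unfolding ascends_def descends_def by linarith

lemma measure_descends_shift: "m {s. descends (n + 1) s} = m {s. descends n s}"
proof -
  have "m {s. descends (n + 1) s} = m ((\<lambda>s. \<gamma> \<otimes> s) -` {s. descends (n + 1) s})"
    by (rule left_invariant[symmetric]) simp
  also have "\<dots> = m {s. descends n s}"
    using axis_dist_translate[of _ n] axis_dist_translate[of _ "n - 1"]
    by (intro measure_cong_carrier) (simp add: descends_def)
  finally show ?thesis .
qed

text \<open>The two sets cover \<open>G\<close> by quasi-convexity, so their measures sum to at least 1. On the other
  hand \<open>ascends n\<close> is disjoint from \<open>descends (n + 1)\<close>, which has the same measure as \<open>descends n\<close>,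
  so the sum is at most 1. Hence the set where the distance has a local minimum is null: the mean
  escapes to the ends of the axis.\<close>

lemma measure_ascends_descends: "m {s. ascends n s} + m {s. descends n s} = 1"
proof -
  have cover: "carrier G \<subseteq> {s. ascends n s} \<union> {s. descends n s}"
    using ascends_or_descends by blast
  have "1 \<le> m ({s. ascends n s} \<union> {s. descends n s})"
    using mono[OF cover] concentrated by simp
  also have "\<dots> \<le> m {s. ascends n s} + m {s. descends n s}"
    using additive[of "{s. ascends n s}" "{s. descends n s} - {s. ascends n s}"]
      mono[of "{s. descends n s} - {s. ascends n s}" "{s. descends n s}"] by simp
  finally have "1 \<le> m {s. ascends n s} + m {s. descends n s}" .
  moreover have "m {s. ascends n s} + m {s. descends (n + 1) s} \<le> 1"
  proof -
    have "{s. ascends n s} \<inter> {s. descends (n + 1) s} = {}"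
      by (auto simp: ascends_def descends_def)
    then show ?thesis
      using additive mono[of "{s. ascends n s} \<union> {s. descends (n + 1) s}" UNIV] total by simp
  qed
  ultimately show ?thesis
    by (simp add: measure_descends_shift)
qed

lemma almost_all_descends_iff:
  "eventually (\<lambda>s. descends n s \<longleftrightarrow> \<not> ascends n s) almost_all"
proof -
  have "carrier G \<subseteq> {s. ascends n s} \<union> {s. descends n s}"
    using ascends_or_descends by blast
  then show ?thesis
    using almost_all_complementary[OF measure_ascends_descends[of n]] by simp
qed

lemma almost_all_ascends_shift:
  "eventually (\<lambda>s. ascends (n + 1) s \<longleftrightarrow> ascends n s) almost_all"
proof -
  have "m {s. ascends n s} + m {s. descends (n + 1) s} = 1"
    using measure_ascends_descends by (simp add: measure_descends_shift)
  then have "eventually (\<lambda>s. s \<in> {s. descends (n + 1) s} \<longleftrightarrow> s \<notin> {s. ascends n s}) almost_all"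
    by (rule almost_all_complementary) (auto simp: ascends_def descends_def)
  with almost_all_descends_iff[of "n + 1"] show ?thesis
    by eventually_elim auto
qed

lemma almost_all_ascends_iff: "eventually (\<lambda>s. ascends n s \<longleftrightarrow> ascends 0 s) almost_all"
proof (induction n rule: int_induct[where k = 0])
  case (step1 i)
  show ?case
    using almost_all_ascends_shift[of i] step1(2) by eventually_elim simp
next
  case (step2 i)
  show ?case
    using almost_all_ascends_shift[of "i - 1"] step2(2) by eventually_elim simp
qed simp

text \<open>Points seen from which the axis is traversed monotonically on the window \<open>[-M, M]\<close>. A finite
  window is needed because finitely many null sets may be discarded, but not countably many.\<close>

definition monotone_up_to :: "nat \<Rightarrow> 'g \<Rightarrow> bool" where
  "monotone_up_to M s \<longleftrightarrow> s \<in> carrier G \<and>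
     (\<forall>n\<in>{- int M..int M}. (ascends n s \<longleftrightarrow> ascends 0 s) \<and> (descends n s \<longleftrightarrow> \<not> ascends 0 s))"

lemma almost_all_monotone_up_to: "eventually (monotone_up_to M) almost_all"
proof -
  have "eventually (\<lambda>s. (ascends n s \<longleftrightarrow> ascends 0 s) \<and> (descends n s \<longleftrightarrow> \<not> ascends 0 s)) almost_all" for n
    using almost_all_ascends_iff[of n] almost_all_descends_iff[of n] by eventually_elim auto
  then have "eventually (\<lambda>s. \<forall>n\<in>{- int M..int M}. (ascends n s \<longleftrightarrow> ascends 0 s) \<and>
      (descends n s \<longleftrightarrow> \<not> ascends 0 s)) almost_all"
    by (intro eventually_ball_finite) auto
  then show ?thesis
    using almost_all_carrier unfolding monotone_up_to_def by eventually_elim blast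
qed

lemma monotone_up_to_carrier: "monotone_up_to M s \<Longrightarrow> s \<in> carrier G"
  unfolding monotone_up_to_def by blast

lemma monotone_step:
  assumes "monotone_up_to M s" "n \<in> {- int M..int M}"
  shows "ascends 0 s \<Longrightarrow> axis_dist s n + (\<delta> + 1) \<le> axis_dist s (n + 1)"
    and "\<not> ascends 0 s \<Longrightarrow> axis_dist s n + (\<delta> + 1) \<le> axis_dist s (n - 1)"
proof -
  have "s \<in> carrier G" and asc: "ascends n s \<longleftrightarrow> ascends 0 s"
    and desc: "descends n s \<longleftrightarrow> \<not> ascends 0 s"
    using assms unfolding monotone_up_to_def by blast+
  note conv = quasi_convex[OF this(1), of n]
  show "axis_dist s n + (\<delta> + 1) \<le> axis_dist s (n + 1)" if "ascends 0 s"
    using that desc conv delta_nonneg unfolding descends_def by linarith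
  show "axis_dist s n + (\<delta> + 1) \<le> axis_dist s (n - 1)" if "\<not> ascends 0 s"
    using that asc conv delta_nonneg unfolding ascends_def by linarith
qed

lemma monotone_steps:
  assumes "monotone_up_to M s" "k \<le> M"
  shows "ascends 0 s \<Longrightarrow> axis_dist s (- int k) + k * (\<delta> + 1) \<le> axis_dist s 0"
    and "\<not> ascends 0 s \<Longrightarrow> axis_dist s (int k) + k * (\<delta> + 1) \<le> axis_dist s 0"
  using assms(2)
proof (induction k)
  case (Suc k)
  {
    case 1
    have "axis_dist s (- int (Suc k)) + (\<delta> + 1) \<le> axis_dist s (- int k)"
      using monotone_step(1)[OF assms(1), of "- int (Suc k)"] 1 by simp
    then show ?case
      using Suc.IH(1) 1 by (simp add: algebra_simps)
  next
    case 2
    have "axis_dist s (int (Suc k)) + (\<delta> + 1) \<le> axis_dist s (int k)"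
      using monotone_step(2)[OF assms(1), of "int (Suc k)"] 2 by simp
    then show ?case
      using Suc.IH(2) 2 by (simp add: algebra_simps)
  }
qed simp_all

text \<open>Twice the Gromov product of \<open>s\<close> and \<open>t\<close> based at \<open>h\<close>. It separates the two ends of the axis: it is
  at least linear in \<open>M\<close> for two points at the same end, and bounded for points at opposite
  ends. Changing the base point alters it by a bounded amount.\<close>

definition doubled_product :: "'g \<Rightarrow> 'g \<Rightarrow> 'g \<Rightarrow> real" where
  "doubled_product h s t = \<rho> h s + \<rho> h t - \<rho> s t"

lemma doubled_product_same_side:
  assumes s: "monotone_up_to M s" and t: "monotone_up_to M t"
    and same: "ascends 0 s \<longleftrightarrow> ascends 0 t"
  shows "M * (\<delta> + 1) - 2 * \<delta> \<le> doubled_product \<one> s t"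
proof -
  (* the far end of the window on the side of s and t *)
  define k where "k = (if ascends 0 s then - int M else int M)"
  have G: "s \<in> carrier G" "t \<in> carrier G"
    using s t by (blast intro: monotone_up_to_carrier)+
  have "axis_dist s k + M * (\<delta> + 1) \<le> axis_dist s 0" "axis_dist t k + M * (\<delta> + 1) \<le> axis_dist t 0"
    using monotone_steps[OF s, of M] monotone_steps[OF t, of M] same by (auto simp: k_def)
  moreover have "\<rho> s t + \<rho> \<one> (\<gamma> [^] k) \<le>
      max (\<rho> s \<one> + \<rho> t (\<gamma> [^] k)) (\<rho> s (\<gamma> [^] k) + \<rho> \<one> t) + 2 * \<delta>"
    using G by (intro four_point) auto
  ultimately show ?thesis
    using dist_nonneg[of \<one> "\<gamma> [^] k"] dist_sym[of \<one> s] dist_sym[of \<one> t]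
    unfolding axis_dist_def doubled_product_def by auto
qed

lemma doubled_product_opposite_sides:
  assumes s: "monotone_up_to M s" and t: "monotone_up_to M t" and M: "M \<ge> 1"
    and opposite: "ascends 0 s \<longleftrightarrow> \<not> ascends 0 t"
  shows "doubled_product \<one> s t \<le> \<rho> \<one> \<gamma> + 2 * \<delta>"
proof -
  have *: "doubled_product \<one> s t \<le> \<rho> \<one> \<gamma> + 2 * \<delta>"
    if s: "monotone_up_to M s" and t: "monotone_up_to M t"
      and st: "\<not> ascends 0 s" "ascends 0 t" for s t
  proof -
    have G: "s \<in> carrier G" "t \<in> carrier G"
      using s t by (blast intro: monotone_up_to_carrier)+
    have "axis_dist s 0 + (\<delta> + 1) \<le> axis_dist s (- 1)" "axis_dist t (- 1) + (\<delta> + 1) \<le> axis_dist t 0"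
      using monotone_step(2)[OF s _ st(1), of 0] monotone_step(1)[OF t _ st(2), of "- 1"] M by auto
    moreover have "\<rho> s (\<gamma> [^] (-1::int)) + \<rho> t \<one> \<le>
        max (\<rho> s t + \<rho> (\<gamma> [^] (-1::int)) \<one>) (\<rho> s \<one> + \<rho> t (\<gamma> [^] (-1::int))) + 2 * \<delta>"
      using G by (intro four_point) auto
    moreover have "\<rho> (\<gamma> [^] (-1::int)) \<one> = \<rho> \<one> \<gamma>"
      using dist_powers[of "-1" 0] by simp
    ultimately show ?thesis
      using dist_sym[of \<one> s] dist_sym[of \<one> t]
      unfolding axis_dist_def doubled_product_def int_pow_0 using delta_nonneg by linarith
  qed
  show ?thesis
  proof (cases "ascends 0 s")
    case True
    then have "doubled_product \<one> t s \<le> \<rho> \<one> \<gamma> + 2 * \<delta>"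
      using * s t opposite by blast
    then show ?thesis
      by (simp add: doubled_product_def dist_sym add.commute)
  next
    case False
    then show ?thesis
      using * s t opposite by blast
  qed
qed

lemma doubled_product_translate:
  assumes "h \<in> carrier G" "s \<in> carrier G" "t \<in> carrier G"
  shows "\<bar>doubled_product \<one> (h \<otimes> s) (h \<otimes> t) - doubled_product \<one> s t\<bar> \<le> 2 * \<rho> \<one> h"
proof -
  have "\<bar>\<rho> \<one> (h \<otimes> x) - \<rho> \<one> x\<bar> \<le> \<rho> \<one> h" if "x \<in> carrier G" for x
    using dist_translate[of h \<one> x] dist_triangle[of \<one> h "h \<otimes> x"] dist_triangle[of h \<one> "h \<otimes> x"]
      dist_sym[of h \<one>] assms(1) that by auto
  from this[of s] this[of t] show ?thesis
    using dist_translate[OF assms] assms(2,3) unfolding doubled_product_def by linarith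
qed

text \<open>For a window large compared with the displacement of \<open>h\<close>, the large and the bounded values of the
  Gromov product remain separated after the change of base point from the identity to \<open>h\<close>. Being at
  the same end is therefore invariant under translation by \<open>h\<close>.\<close>

lemma side_relation_invariant:
  assumes h: "h \<in> carrier G"
    and M: "\<rho> \<one> \<gamma> + 4 * \<delta> + 2 * \<rho> \<one> h < M * (\<delta> + 1)"
    and st: "monotone_up_to M s" "monotone_up_to M t"
    and hst: "monotone_up_to M (h \<otimes> s)" "monotone_up_to M (h \<otimes> t)"
  shows "(ascends 0 (h \<otimes> s) \<longleftrightarrow> ascends 0 (h \<otimes> t)) \<longleftrightarrow> (ascends 0 s \<longleftrightarrow> ascends 0 t)"
proof -
  have "M \<noteq> 0"
    using M delta_nonneg dist_nonneg[of \<one> \<gamma>] dist_nonneg[of \<one> h] by (intro notI) simp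
  then have M1: "M \<ge> 1"
    by simp
  have "s \<in> carrier G" "t \<in> carrier G"
    using st by (blast intro: monotone_up_to_carrier)+
  note diff = doubled_product_translate[OF h this]
  show ?thesis
  proof (cases "ascends 0 s \<longleftrightarrow> ascends 0 t")
    case True
    then have "\<rho> \<one> \<gamma> + 2 * \<delta> < doubled_product \<one> (h \<otimes> s) (h \<otimes> t)"
      using doubled_product_same_side[OF st True] diff M by linarith
    then show ?thesis
      using doubled_product_opposite_sides[OF hst M1] True by fastforce
  next
    case False
    then have "doubled_product \<one> (h \<otimes> s) (h \<otimes> t) < M * (\<delta> + 1) - 2 * \<delta>"
      using doubled_product_opposite_sides[OF st M1] diff M by linarith
    then show ?thesis
      using doubled_product_same_side[OF hst] False by linarith
  qed
qed

text \<open>The value 0 off the carrier makes the integrands below bounded on the whole type, although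
  \<open>\<rho>\<close> need not satisfy the triangle inequality there.\<close>

definition side :: "'g \<Rightarrow> real" where
  "side s = (if s \<notin> carrier G then 0 else if ascends 0 s then 1 else - 1)"

text \<open>The sign is read off from one generic point \<open>t\<close>; every other generic point is compared with it.\<close>

lemma almost_all_side_translate:
  assumes h: "h \<in> carrier G"
  obtains c where "c = 1 \<or> c = - 1" "eventually (\<lambda>s. side (h \<otimes> s) = c * side s) almost_all"
proof -
  obtain M :: nat where "\<rho> \<one> \<gamma> + 4 * \<delta> + 2 * \<rho> \<one> h < M"
    using reals_Archimedean2 by blast
  also have "real M \<le> M * (\<delta> + 1)"
    using delta_nonneg by (simp add: mult_le_cancel_left1)
  finally have M: "\<rho> \<one> \<gamma> + 4 * \<delta> + 2 * \<rho> \<one> h < M * (\<delta> + 1)" .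
  define E where "E s \<longleftrightarrow> monotone_up_to M s \<and> monotone_up_to M (h \<otimes> s)" for s
  have E: "eventually E almost_all"
    unfolding E_def
    by (rule eventually_conj[OF almost_all_monotone_up_to
          almost_all_translate[OF almost_all_monotone_up_to h]])
  then obtain t where t: "E t"
    using almost_all_neq_bot eventually_happens by blast
  have tG: "t \<in> carrier G" "h \<otimes> t \<in> carrier G"
    using t unfolding E_def by (blast intro: monotone_up_to_carrier)+
  show ?thesis
  proof
    show "side (h \<otimes> t) * side t = 1 \<or> side (h \<otimes> t) * side t = - 1"
      using tG by (simp add: side_def)
    show "eventually (\<lambda>s. side (h \<otimes> s) = side (h \<otimes> t) * side t * side s) almost_all"
      using E
    proof eventually_elim
      case (elim s)
      then have "s \<in> carrier G" "h \<otimes> s \<in> carrier G"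
        unfolding E_def by (blast intro: monotone_up_to_carrier)+
      then show ?case
        using side_relation_invariant[OF h M, of s t] elim t tG by (auto simp: E_def side_def)
    qed
  qed
qed

text \<open>Whether \<open>h\<close> fixes or exchanges the two ends of the axis, as seen by the mean. If the mean charges
  only one end, the value is 1.\<close>

definition orientation :: "'g \<Rightarrow> real" where
  "orientation h = (if eventually (\<lambda>s. side (h \<otimes> s) = side s) almost_all then 1 else - 1)"

lemma orientation_cases: "orientation h = 1 \<or> orientation h = - 1"
  by (simp add: orientation_def)

lemma almost_all_orientation:
  assumes "h \<in> carrier G"
  shows "eventually (\<lambda>s. side (h \<otimes> s) = orientation h * side s) almost_all"
  by (rule almost_all_side_translate[OF assms]) (auto simp: orientation_def)

lemma orientation_unique:
  assumes h: "h \<in> carrier G" and ev: "eventually (\<lambda>s. side (h \<otimes> s) = c * side s) almost_all"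
  shows "orientation h = c"
proof -
  have "eventually (\<lambda>s. orientation h = c) almost_all"
    using almost_all_orientation[OF h] ev almost_all_carrier
  proof eventually_elim
    case (elim s)
    have "orientation h * side s = c * side s"
      using trans[OF sym[OF elim(1)] elim(2)] .
    moreover have "side s \<noteq> 0"
      using elim(3) by (simp add: side_def)
    ultimately show ?case
      by simp
  qed
  then show ?thesis
    using almost_all_neq_bot by (simp add: eventually_const)
qed

lemma orientation_mult:
  assumes h: "h \<in> carrier G" and k: "k \<in> carrier G"
  shows "orientation (h \<otimes> k) = orientation h * orientation k"
proof (rule orientation_unique)
  show "eventually (\<lambda>s. side (h \<otimes> k \<otimes> s) = orientation h * orientation k * side s) almost_all"
    using almost_all_translate[OF almost_all_orientation[OF h] k] almost_all_orientation[OF k]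
      almost_all_carrier
  proof eventually_elim
    case (elim s)
    then show ?case
      using h k by (simp add: m_assoc)
  qed
qed (use h k in simp)

text \<open>A Busemann function averaged over the mean, where the two ends contribute with opposite signs. The
  signs make it equivariant under elements that exchange the ends, and keep the contributions of the
  ends to the drift of \<open>\<gamma>\<close> from cancelling.\<close>

definition drift :: "'g \<Rightarrow> real" where
  "drift h = integral (\<lambda>s. side s * (\<rho> h s - \<rho> \<one> s))"

lemma dist_difference_bounded:
  assumes "h \<in> carrier G" "k \<in> carrier G"
  shows "\<bar>side s * (\<rho> h s - \<rho> k s)\<bar> \<le> \<rho> h k"
proof (cases "s \<in> carrier G")
  case True
  then have "\<bar>\<rho> h s - \<rho> k s\<bar> \<le> \<rho> h k"
    using dist_triangle[of h k s] dist_triangle[of k h s] dist_sym[of h k] assms by auto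
  moreover have "\<bar>side s\<bar> = 1"
    using True by (simp add: side_def)
  ultimately show ?thesis
    by (simp add: abs_mult)
qed (simp add: side_def dist_nonneg)

text \<open>Split \<open>\<rho> (h \<otimes> k) s - \<rho> \<one> s\<close> at \<open>\<rho> h s\<close> and translate the first part back by \<open>h\<close>, which multiplies
  it by the orientation of \<open>h\<close>. Invariance of the mean gives an exact identity, where Busemann
  functions alone only give one up to a bounded error.\<close>

lemma drift_mult:
  assumes h: "h \<in> carrier G" and k: "k \<in> carrier G"
  shows "drift (h \<otimes> k) = drift h + orientation h * drift k"
proof -
  let ?F = "\<lambda>s. side s * (\<rho> (h \<otimes> k) s - \<rho> h s)"
  let ?H = "\<lambda>s. side s * (\<rho> k s - \<rho> \<one> s)"
  have "drift (h \<otimes> k) = integral (\<lambda>s. ?F s + side s * (\<rho> h s - \<rho> \<one> s))"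
    unfolding drift_def by (simp add: algebra_simps)
  also have "\<dots> = integral ?F + drift h"
    unfolding drift_def
    by (rule integral_add[where B = "\<rho> (h \<otimes> k) h" and C = "\<rho> h \<one>"])
      (use h k in \<open>auto intro!: dist_difference_bounded\<close>)
  also have "integral ?F = integral (\<lambda>s. ?F (h \<otimes> s))"
    using h k by (intro integral_measure_preserving[where B = "\<rho> (h \<otimes> k) h", symmetric]
        left_invariant dist_difference_bounded) auto
  also have "\<dots> = integral (\<lambda>s. orientation h * ?H s)"
  proof (rule integral_cong_AE)
    show "eventually (\<lambda>s. ?F (h \<otimes> s) = orientation h * ?H s) almost_all"
      using almost_all_orientation[OF h] almost_all_carrier
    proof eventually_elim
      case (elim s)
      then have "\<rho> (h \<otimes> k) (h \<otimes> s) = \<rho> k s" "\<rho> h (h \<otimes> s) = \<rho> \<one> s"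
        using h k dist_translate[of h k s] dist_translate[of h \<one> s] by auto
      then show ?case
        using elim by simp
    qed
    show "\<bar>?F (h \<otimes> s)\<bar> \<le> \<rho> (h \<otimes> k) h" for s
      using h k by (intro dist_difference_bounded) auto
    show "\<bar>orientation h * ?H s\<bar> \<le> \<rho> k \<one>" for s
      using dist_difference_bounded[OF k one_closed, of s] orientation_cases[of h] by auto
  qed
  also have "\<dots> = orientation h * drift k"
    using orientation_cases[of h] integral_minus[OF dist_difference_bounded[OF k one_closed]]
    unfolding drift_def by auto
  finally show ?thesis
    by simp
qed

lemma orientation_gamma: "orientation \<gamma> = 1"
proof (rule orientation_unique)
  have "eventually (\<lambda>s. ascends (- 1) s \<longleftrightarrow> ascends 0 s) almost_all"
    by (rule almost_all_ascends_iff)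
  then show "eventually (\<lambda>s. side (\<gamma> \<otimes> s) = 1 * side s) almost_all"
    using almost_all_carrier
  proof eventually_elim
    case (elim s)
    then show ?case
      using axis_dist_translate[of s "- 1"] axis_dist_translate[of s 0] by (auto simp: side_def ascends_def)
  qed
qed simp

lemma drift_gamma_pos: "0 < drift \<gamma>"
proof -
  have "\<delta> + 1 = integral (\<lambda>s. \<delta> + 1)"
    by (simp add: integral_const)
  also have "\<dots> \<le> drift \<gamma>"
    unfolding drift_def
  proof (rule integral_mono_AE)
    show "eventually (\<lambda>s. \<delta> + 1 \<le> side s * (\<rho> \<gamma> s - \<rho> \<one> s)) almost_all"
      using almost_all_monotone_up_to[of 1]
    proof eventually_elim
      case (elim s)
      then have "s \<in> carrier G"
        by (rule monotone_up_to_carrier)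
      then show ?case
        using monotone_step(1)[OF elim, of 0] monotone_step(2)[OF elim, of 1]
        by (auto simp: side_def axis_dist_def dist_sym[of \<gamma> s] dist_sym[of \<one> s])
    qed
    show "\<bar>side s * (\<rho> \<gamma> s - \<rho> \<one> s)\<bar> \<le> \<rho> \<gamma> \<one>" for s
      by (intro dist_difference_bounded) auto
  qed auto
  finally show ?thesis
    using delta_nonneg by linarith
qed

end

section \<open>From loxodromic elements to homomorphisms\<close>

context amenable_hyperbolic_group
begin

lemma exists_hom_with_translation:
  "\<exists>f \<in> hom G real_semidirect_Z2. \<exists>a. f \<gamma> = (a, 0) \<and> a \<noteq> 0"
proof
  let ?f = "\<lambda>h. (drift h, if orientation h = 1 then 0 else 1 :: int)"
  show "?f \<in> hom G real_semidirect_Z2"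
  proof (rule homI)
    fix h k assume "h \<in> carrier G" "k \<in> carrier G"
    then show "?f (h \<otimes> k) = ?f h \<otimes>\<^bsub>real_semidirect_Z2\<^esub> ?f k"
      using orientation_cases[of h] orientation_cases[of k]
      by (auto simp: mult_real_semidirect_Z2 drift_mult orientation_mult)
  qed (simp add: carrier_real_semidirect_Z2)
  show "\<exists>a. ?f \<gamma> = (a, 0) \<and> a \<noteq> 0"
    using drift_gamma_pos by (simp add: orientation_gamma)
qed

end

text \<open>The three elements \<open>\<one>\<close>, \<open>x\<close> and \<open>x\<^sup>2\<close> have distinct images.\<close>

lemma large_image_if_translation:
  assumes "group G" "f \<in> hom G real_semidirect_Z2" "x \<in> carrier G" "f x = (a, 0)" "a \<noteq> 0"
  shows "\<not> (finite (f ` carrier G) \<and> card (f ` carrier G) \<le> 2)"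
proof
  interpret group_hom G real_semidirect_Z2 f
    using assms(1,2) group_real_semidirect_Z2 by (simp add: group_hom_def group_hom_axioms_def)
  assume small: "finite (f ` carrier G) \<and> card (f ` carrier G) \<le> 2"
  have "f \<one>\<^bsub>G\<^esub> = (0, 0)" "f (x \<otimes>\<^bsub>G\<^esub> x) = (2 * a, 0)"
    using assms by (auto simp: one_real_semidirect_Z2 mult_real_semidirect_Z2)
  then have "{(0, 0), (a, 0), (2 * a, 0)} \<subseteq> f ` carrier G"
    using assms(3,4) G.one_closed G.m_closed by (metis empty_subsetI image_eqI insert_subset)
  then have "card {(0, 0 :: int), (a, 0), (2 * a, 0)} \<le> 2"
    using small card_mono order_trans by blast
  then show False
    using assms(5) by (simp add: card_insert_if)
qed

lemma left_invariant_pseudometric_orbit: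
  fixes G (structure)
  assumes G: "group G" and act: "isometric_action G X \<phi>" and x: "x \<in> mspace X"
  shows "left_invariant_pseudometric G (\<lambda>g h. mdist X (\<phi> g x) (\<phi> h x))"
proof -
  interpret group G by (rule G)
  interpret group_action G "mspace X" \<phi>
    using act by (simp add: isometric_action_def)
  have [simp]: "\<phi> g x \<in> mspace X" if "g \<in> carrier G" for g
    using element_image[OF that x] by simp
  show ?thesis
  proof
    fix h g k assume "h \<in> carrier G" "g \<in> carrier G" "k \<in> carrier G"
    then show "mdist X (\<phi> (h \<otimes>\<^bsub>G\<^esub> g) x) (\<phi> (h \<otimes>\<^bsub>G\<^esub> k) x) = mdist X (\<phi> g x) (\<phi> k x)"
      using act x by (simp add: composition_rule isometric_action_def)
  qed (auto simp: mdist_commute mdist_triangle)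
qed

lemma gromov_hyperbolic_four_point:
  assumes "gromov_hyperbolic X"
  obtains \<delta> where "0 \<le> \<delta>"
    and "\<And>w x y z. \<lbrakk>w \<in> mspace X; x \<in> mspace X; y \<in> mspace X; z \<in> mspace X\<rbrakk> \<Longrightarrow>
      mdist X x z + mdist X y w \<le>
        max (mdist X x y + mdist X z w) (mdist X x w + mdist X y z) + 2 * \<delta>"
proof -
  obtain \<delta> where \<delta>: "0 \<le> \<delta>" "\<forall>w\<in>mspace X. \<forall>x\<in>mspace X. \<forall>y\<in>mspace X. \<forall>z\<in>mspace X.
      gromov_product X w x z \<ge> min (gromov_product X w x y) (gromov_product X w y z) - \<delta>"
    using assms unfolding gromov_hyperbolic_def by blast
  show ?thesis
  proof (rule that[OF \<delta>(1)])
    fix w x y z assume "w \<in> mspace X" "x \<in> mspace X" "y \<in> mspace X" "z \<in> mspace X"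
    then have "gromov_product X w x z \<ge> min (gromov_product X w x y) (gromov_product X w y z) - \<delta>"
      using \<delta>(2) by blast
    then consider "gromov_product X w x y - \<delta> \<le> gromov_product X w x z"
      | "gromov_product X w y z - \<delta> \<le> gromov_product X w x z"
      by (auto simp: min_def split: if_splits)
    then show "mdist X x z + mdist X y w \<le>
        max (mdist X x y + mdist X z w) (mdist X x w + mdist X y z) + 2 * \<delta>"
    proof cases
      case 1
      then have "mdist X x z + mdist X y w \<le> (mdist X x y + mdist X z w) + 2 * \<delta>"
        unfolding gromov_product_def mdist_commute[of X w] by argo
      then show ?thesis by linarith
    next
      case 2
      then have "mdist X x z + mdist X y w \<le> (mdist X x w + mdist X y z) + 2 * \<delta>"
        unfolding gromov_product_def mdist_commute[of X w] by argo
      then show ?thesis by linarith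
    qed
  qed
qed

text \<open>Otherwise \<open>d (2 ^ k)\<close> would grow at most linearly in \<open>k\<close>. For the displacements \<open>d n\<close> of the powers
  of a loxodromic element, a \<open>k\<close> as in the conclusion makes \<open>2 ^ k\<close> the exponent of a power that
  satisfies the stretching condition.\<close>

lemma exists_doubling_step:
  fixes d :: "nat \<Rightarrow> real"
  assumes K: "K > 0" and grow: "\<And>n. n / K - C \<le> d n"
  shows "\<exists>k. d (2 ^ k) + c \<le> d (2 ^ Suc k)"
proof (rule ccontr)
  assume "\<not> ?thesis"
  then have step: "d (2 ^ Suc k) \<le> d (2 ^ k) + c" for k
    by (meson le_cases not_le)
  have upper: "d (2 ^ k) \<le> d 1 + k * c" for k
  proof (induction k)
    case (Suc k)
    then show ?case
      using step[of k] by (simp add: algebra_simps)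
  qed simp
  have "eventually (\<lambda>k::nat. d 1 + k * c < 2 ^ k / K - C) at_top"
    using K by real_asymp
  then obtain k :: nat where "d 1 + k * c < 2 ^ k / K - C"
    by (meson eventually_sequentially order_refl)
  then show False
    using upper[of k] grow[of "2 ^ k"] by simp
qed

lemma left_invariant_mean_of_amenable:
  fixes G (structure)
  assumes "amenable_group G"
  obtains m where "left_invariant_mean G m"
proof -
  interpret group G
    using assms by (simp add: amenable_group_def)
  obtain \<mu> :: "'a set \<Rightarrow> real" where
    \<mu>: "\<forall>A. A \<subseteq> carrier G \<longrightarrow> \<mu> A \<ge> 0" "\<mu> (carrier G) = 1"
      "\<forall>A B. A \<subseteq> carrier G \<longrightarrow> B \<subseteq> carrier G \<longrightarrow> A \<inter> B = {} \<longrightarrow> \<mu> (A \<union> B) = \<mu> A + \<mu> B"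
      "\<forall>g\<in>carrier G. \<forall>A. A \<subseteq> carrier G \<longrightarrow> \<mu> (g <#\<^bsub>G\<^esub> A) = \<mu> A"
    using assms unfolding amenable_group_def by (elim conjE exE) (rule that)
  have cancel: "inv h \<otimes> (h \<otimes> s) = s" "h \<otimes> (inv h \<otimes> s) = s"
    if "h \<in> carrier G" "s \<in> carrier G" for h s
    using that by (simp_all add: m_assoc[symmetric])
  have "left_invariant_mean G (\<lambda>A. \<mu> (A \<inter> carrier G))"
  proof
    fix A B :: "'a set" assume "A \<inter> B = {}"
    then have "\<mu> ((A \<inter> carrier G) \<union> (B \<inter> carrier G)) = \<mu> (A \<inter> carrier G) + \<mu> (B \<inter> carrier G)"
      using \<mu>(3)[rule_format, of "A \<inter> carrier G" "B \<inter> carrier G"] by blast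
    then show "\<mu> ((A \<union> B) \<inter> carrier G) = \<mu> (A \<inter> carrier G) + \<mu> (B \<inter> carrier G)"
      by (simp add: Int_Un_distrib2)
  next
    fix h A assume h: "h \<in> carrier G"
    have "(\<lambda>s. h \<otimes> s) -` A \<inter> carrier G = inv h <# (A \<inter> carrier G)"
    proof (intro equalityI subsetI)
      fix s assume "s \<in> (\<lambda>s. h \<otimes> s) -` A \<inter> carrier G"
      then show "s \<in> inv h <# (A \<inter> carrier G)"
        using h cancel(1)[of h s] unfolding l_coset_def
        by (intro UN_I[of "h \<otimes> s"]) simp_all
    next
      fix s assume "s \<in> inv h <# (A \<inter> carrier G)"
      then show "s \<in> (\<lambda>s. h \<otimes> s) -` A \<inter> carrier G"
        using h cancel(2) by (auto simp: l_coset_def)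
    qed
    then show "\<mu> ((\<lambda>s. h \<otimes> s) -` A \<inter> carrier G) = \<mu> (A \<inter> carrier G)"
      using \<mu>(4) h by simp
  qed (simp_all add: \<mu>(1,2))
  then show ?thesis
    by (rule that)
qed

theorem amenable_loxodromic_imp_large_image:
  fixes G (structure)
  assumes am: "amenable_group G" and hyp: "gromov_hyperbolic X"
    and act: "isometric_action G X \<phi>" and g: "g \<in> carrier G" and lox: "loxodromic G X \<phi> g"
  shows "\<exists>f \<in> hom G real_semidirect_Z2. \<not> (finite (f ` carrier G) \<and> card (f ` carrier G) \<le> 2)"
proof -
  interpret group G
    using am by (simp add: amenable_group_def)
  interpret action: group_action G "mspace X" \<phi>
    using act by (simp add: isometric_action_def)
  obtain m where "left_invariant_mean G m"
    using am by (rule left_invariant_mean_of_amenable)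
  then interpret left_invariant_mean G m .
  obtain x where x: "x \<in> mspace X"
    and qi: "quasi_isometric_embedding integer_metric X (\<lambda>n. \<phi> (g [^]\<^bsub>G\<^esub> n) x)"
    using lox unfolding loxodromic_def by blast
  define \<rho> where "\<rho> = (\<lambda>h k. mdist X (\<phi> h x) (\<phi> k x))"
  interpret left_invariant_pseudometric G \<rho>
    unfolding \<rho>_def by (rule left_invariant_pseudometric_orbit[OF is_group act x])
  have orbit: "\<phi> h x \<in> mspace X" if "h \<in> carrier G" for h
    using action.element_image[OF that x] by simp
  obtain \<delta> where \<delta>: "0 \<le> \<delta>"
    and four: "\<And>w x y z. \<lbrakk>w \<in> mspace X; x \<in> mspace X; y \<in> mspace X; z \<in> mspace X\<rbrakk> \<Longrightarrow>
      mdist X x z + mdist X y w \<le>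
        max (mdist X x y + mdist X z w) (mdist X x w + mdist X y z) + 2 * \<delta>"
    using gromov_hyperbolic_four_point[OF hyp] by metis
  obtain K C where K: "K \<ge> 1" and "\<forall>i\<in>mspace integer_metric. \<forall>j\<in>mspace integer_metric.
      mdist integer_metric i j / K - C \<le> mdist X (\<phi> (g [^]\<^bsub>G\<^esub> i) x) (\<phi> (g [^]\<^bsub>G\<^esub> j) x) \<and>
      mdist X (\<phi> (g [^]\<^bsub>G\<^esub> i) x) (\<phi> (g [^]\<^bsub>G\<^esub> j) x) \<le> K * mdist integer_metric i j + C"
    using qi unfolding quasi_isometric_embedding_def by blast
  then have low: "\<bar>real_of_int i - real_of_int j\<bar> / K - C
      \<le> mdist X (\<phi> (g [^]\<^bsub>G\<^esub> i) x) (\<phi> (g [^]\<^bsub>G\<^esub> j) x)" for i j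
    by simp
  have "\<exists>k. \<rho> \<one> (g [^] (2 ^ k :: nat)) + (3 * \<delta> + 1) \<le> \<rho> \<one> (g [^] (2 ^ Suc k :: nat))"
  proof (rule exists_doubling_step[of K C "\<lambda>n. \<rho> \<one> (g [^] n)"])
    show "real n / K - C \<le> \<rho> \<one> (g [^] n)" for n :: nat
      using low[of 0 "int n"] by (simp add: \<rho>_def int_pow_int)
  qed (use K in simp)
  then obtain k where k: "\<rho> \<one> (g [^] (2 ^ k :: nat)) + (3 * \<delta> + 1) \<le> \<rho> \<one> (g [^] (2 ^ Suc k :: nat))"
    by blast
  define \<gamma> where "\<gamma> = g [^] (2 ^ k :: nat)"
  have \<gamma>: "\<gamma> \<in> carrier G"
    using g by (simp add: \<gamma>_def)
  have "\<gamma> [^] (2 :: int) = \<gamma> [^] (2 :: nat)"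
    using int_pow_int[of G \<gamma> 2] by simp
  also have "\<dots> = g [^] (2 ^ Suc k :: nat)"
    using g by (simp add: \<gamma>_def nat_pow_pow mult.commute)
  finally interpret amenable_hyperbolic_group G m \<rho> \<delta> \<gamma>
    by unfold_locales (use \<gamma> \<delta> k in \<open>simp_all add: \<rho>_def four orbit flip: \<gamma>_def\<close>)
  show ?thesis
    using exists_hom_with_translation large_image_if_translation[OF is_group _ \<gamma>] by blast
qed

section \<open>Isometric actions on a copy of the real line\<close>

text \<open>The real line is transported to the type of points along an injection, because the spaces that
  property (NL) ranges over have to consist of elements of that type.\<close>

definition line_metric :: "(real \<Rightarrow> 'x) \<Rightarrow> 'x metric" where
  "line_metric \<iota> = metric (range \<iota>, \<lambda>u v. \<bar>inv_into UNIV \<iota> u - inv_into UNIV \<iota> v\<bar>)"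

lemma
  assumes "inj \<iota>"
  shows mspace_line_metric: "mspace (line_metric \<iota>) = range \<iota>"
    and mdist_line_metric: "mdist (line_metric \<iota>) = (\<lambda>u v. \<bar>inv_into UNIV \<iota> u - inv_into UNIV \<iota> v\<bar>)"
proof -
  interpret Metric_space "range \<iota>" "\<lambda>u v. \<bar>inv_into UNIV \<iota> u - inv_into UNIV \<iota> v\<bar>"
    using assms by unfold_locales auto
  show "mspace (line_metric \<iota>) = range \<iota>"
    and "mdist (line_metric \<iota>) = (\<lambda>u v. \<bar>inv_into UNIV \<iota> u - inv_into UNIV \<iota> v\<bar>)"
    by (simp_all add: line_metric_def mspace_metric mdist_metric)
qed

lemma hyperbolic_space_line_metric:
  assumes "inj \<iota>"
  shows "hyperbolic_space (line_metric \<iota>)"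
  unfolding hyperbolic_space_def
proof
  note line = mspace_line_metric[OF assms] mdist_line_metric[OF assms] inv_f_f[OF assms]
  show "geodesic_metric_space (line_metric \<iota>)"
    unfolding geodesic_metric_space_def line
  proof (intro ballI)
    fix u v assume "u \<in> range \<iota>" "v \<in> range \<iota>"
    then obtain a b where uv: "u = \<iota> a" "v = \<iota> b"
      by blast
    define e :: real where "e = (if a \<le> b then 1 else - 1)"
    show "\<exists>c. c 0 = u \<and> c \<bar>inv_into UNIV \<iota> u - inv_into UNIV \<iota> v\<bar> = v \<and> c ` {0..\<bar>inv_into UNIV \<iota> u - inv_into UNIV \<iota> v\<bar>} \<subseteq> range \<iota> \<and>
        (\<forall>s\<in>{0..\<bar>inv_into UNIV \<iota> u - inv_into UNIV \<iota> v\<bar>}. \<forall>t\<in>{0..\<bar>inv_into UNIV \<iota> u - inv_into UNIV \<iota> v\<bar>}.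
          \<bar>inv_into UNIV \<iota> (c s) - inv_into UNIV \<iota> (c t)\<bar> = \<bar>s - t\<bar>)"
      by (rule exI[of _ "\<lambda>t. \<iota> (a + e * t)"]) (auto simp: uv line e_def)
  qed
  have tree: "min ((\<bar>w - x\<bar> + \<bar>w - y\<bar> - \<bar>x - y\<bar>) / 2) ((\<bar>w - y\<bar> + \<bar>w - z\<bar> - \<bar>y - z\<bar>) / 2) - 0
      \<le> (\<bar>w - x\<bar> + \<bar>w - z\<bar> - \<bar>x - z\<bar>) / 2" for w x y z :: real
    unfolding min_def by (simp add: abs_if)
  show "gromov_hyperbolic (line_metric \<iota>)"
    unfolding gromov_hyperbolic_def gromov_product_def line
    by (rule exI[of _ 0]) (use tree in blast)
qed

definition line_isometry :: "real \<times> int \<Rightarrow> real \<Rightarrow> real" where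
  "line_isometry p x = (if snd p = 0 then fst p + x else fst p - x)"

lemma line_isometry_mult:
  assumes "p \<in> carrier real_semidirect_Z2" "q \<in> carrier real_semidirect_Z2"
  shows "line_isometry (p \<otimes>\<^bsub>real_semidirect_Z2\<^esub> q) x = line_isometry p (line_isometry q x)"
  using assms by (cases p; cases q)
    (auto simp: line_isometry_def mult_real_semidirect_Z2 carrier_real_semidirect_Z2)

text \<open>The restriction to the image of the injection is part of the notion of a group action, which
  demands extensional bijections.\<close>

definition line_action :: "(real \<Rightarrow> 'x) \<Rightarrow> ('g \<Rightarrow> real \<times> int) \<Rightarrow> 'g \<Rightarrow> 'x \<Rightarrow> 'x" where
  "line_action \<iota> f g = restrict (\<lambda>u. \<iota> (line_isometry (f g) (inv_into UNIV \<iota> u))) (range \<iota>)"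

lemma line_action_apply:
  assumes "inj \<iota>"
  shows "line_action \<iota> f g (\<iota> x) = \<iota> (line_isometry (f g) x)"
  using assms by (simp add: line_action_def)

lemma isometric_action_line_action:
  fixes G (structure)
  assumes inj: "inj \<iota>" and G: "group G" and f: "f \<in> hom G real_semidirect_Z2"
  shows "isometric_action G (line_metric \<iota>) (line_action \<iota> f)"
proof -
  interpret group_hom G real_semidirect_Z2 f
    using G f group_real_semidirect_Z2 by (simp add: group_hom_def group_hom_axioms_def)
  note act = line_action_apply[OF inj]
  have mult: "line_action \<iota> f (g \<otimes> h) u = line_action \<iota> f g (line_action \<iota> f h u)"
    if "g \<in> carrier G" "h \<in> carrier G" "u \<in> range \<iota>" for g h u
    using that by (auto simp: act line_isometry_mult)
  have one: "line_action \<iota> f \<one> u = u" if "u \<in> range \<iota>" for u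
    using that by (auto simp: act one_real_semidirect_Z2 line_isometry_def)
  have closed: "line_action \<iota> f g u \<in> range \<iota>" if "u \<in> range \<iota>" for g u
    using that by (auto simp: act)
  have bij: "line_action \<iota> f g \<in> Bij (range \<iota>)" if "g \<in> carrier G" for g
    unfolding Bij_def
  proof
    show "line_action \<iota> f g \<in> extensional (range \<iota>)"
      by (simp add: line_action_def)
    have "bij_betw (line_action \<iota> f g) (range \<iota>) (range \<iota>)"
      by (rule bij_betw_byWitness[where f' = "line_action \<iota> f (inv\<^bsub>G\<^esub> g)"])
        (use that in \<open>auto simp: closed one simp flip: mult\<close>)
    then show "line_action \<iota> f g \<in> {f. bij_betw f (range \<iota>) (range \<iota>)}"
      by simp
  qed
  have "group_hom G (BijGroup (range \<iota>)) (line_action \<iota> f)"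
    unfolding group_hom_def group_hom_axioms_def
  proof (intro conjI homI)
    fix g h assume gh: "g \<in> carrier G" "h \<in> carrier G"
    show "line_action \<iota> f (g \<otimes> h) = line_action \<iota> f g \<otimes>\<^bsub>BijGroup (range \<iota>)\<^esub> line_action \<iota> f h"
    proof
      fix u
      show "line_action \<iota> f (g \<otimes> h) u =
          (line_action \<iota> f g \<otimes>\<^bsub>BijGroup (range \<iota>)\<^esub> line_action \<iota> f h) u"
        using mult[OF gh, of u] bij[OF gh(1)] bij[OF gh(2)]
        by (cases "u \<in> range \<iota>")
          (simp_all add: BijGroup_def compose_def, simp add: line_action_def)
    qed
  next
    show "line_action \<iota> f g \<in> carrier (BijGroup (range \<iota>))" if "g \<in> carrier G" for g
      using bij[OF that] by (simp add: BijGroup_def)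
  qed (use G in \<open>simp_all add: group_BijGroup\<close>)
  moreover have "\<bar>inv_into UNIV \<iota> (line_action \<iota> f g u) - inv_into UNIV \<iota> (line_action \<iota> f g v)\<bar> =
      \<bar>inv_into UNIV \<iota> u - inv_into UNIV \<iota> v\<bar>" if "u \<in> range \<iota>" "v \<in> range \<iota>" for g u v
    using that inj by (auto simp: act line_isometry_def)
  ultimately show ?thesis
    by (simp add: isometric_action_def group_action_def mspace_line_metric[OF inj]
        mdist_line_metric[OF inj])
qed

lemma int_pow_translation:
  "(a, 0) [^]\<^bsub>real_semidirect_Z2\<^esub> (n :: int) = (n * a, 0)"
proof -
  interpret S: group real_semidirect_Z2
    by (rule group_real_semidirect_Z2)
  have nat: "(a, 0) [^]\<^bsub>real_semidirect_Z2\<^esub> k = (k * a, 0)" for k :: nat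
    by (induction k)
      (simp_all add: one_real_semidirect_Z2 mult_real_semidirect_Z2 algebra_simps)
  have "inv\<^bsub>real_semidirect_Z2\<^esub> (b, 0) = (- b, 0)" for b
    by (rule S.inv_equality)
      (simp_all add: one_real_semidirect_Z2 mult_real_semidirect_Z2 carrier_real_semidirect_Z2)
  then show ?thesis
    by (cases n rule: int_cases2)
      (simp_all add: int_pow_int nat S.int_pow_neg_int carrier_real_semidirect_Z2)
qed

lemma not_property_NL_if_translation:
  fixes \<iota> :: "real \<Rightarrow> 'x"
  assumes inj: "inj \<iota>" and G: "group G" and f: "f \<in> hom G real_semidirect_Z2"
    and g: "g \<in> carrier G" and fg: "f g = (a, 0)" "a \<noteq> 0"
  shows "\<not> property_NL TYPE('x) G"
proof -
  have "f (g [^]\<^bsub>G\<^esub> n) = (n * a, 0)" for n :: int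
    using hom_int_pow[OF f g G group_real_semidirect_Z2, of n] fg by (simp add: int_pow_translation)
  then have orbit: "line_action \<iota> f (g [^]\<^bsub>G\<^esub> n) (\<iota> 0) = \<iota> (n * a)" for n :: int
    by (simp add: line_action_apply[OF inj] line_isometry_def)
  (* multiplying an integer distance by the translation length distorts it by at most K *)
  define K where "K = max 1 (max \<bar>a\<bar> (1 / \<bar>a\<bar>))"
  have K: "K \<ge> 1" "\<bar>a\<bar> \<le> K" "1 / K \<le> \<bar>a\<bar>"
  proof -
    show "K \<ge> 1" "\<bar>a\<bar> \<le> K"
      by (simp_all add: K_def)
    have "1 / \<bar>a\<bar> \<le> K"
      by (simp add: K_def)
    then show "1 / K \<le> \<bar>a\<bar>"
      using \<open>K \<ge> 1\<close> fg(2) by (simp add: field_simps)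
  qed
  have "real_of_int \<bar>i - j\<bar> / K \<le> \<bar>a\<bar> * real_of_int \<bar>i - j\<bar>" "\<bar>a\<bar> * real_of_int \<bar>i - j\<bar> \<le> K * real_of_int \<bar>i - j\<bar>" for i j :: int
    using mult_right_mono[OF K(3), of "real_of_int \<bar>i - j\<bar>"] mult_right_mono[OF K(2), of "real_of_int \<bar>i - j\<bar>"]
    by simp_all
  moreover have "\<bar>real_of_int i * a - real_of_int j * a\<bar> = \<bar>a\<bar> * real_of_int \<bar>i - j\<bar>" for i j :: int
  proof -
    have "real_of_int i * a - real_of_int j * a = a * real_of_int (i - j)"
      by (simp add: algebra_simps)
    then show ?thesis
      by (simp add: abs_mult)
  qed
  ultimately have "quasi_isometric_embedding integer_metric (line_metric \<iota>)
      (\<lambda>n. line_action \<iota> f (g [^]\<^bsub>G\<^esub> n) (\<iota> 0))"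
    unfolding quasi_isometric_embedding_def orbit mspace_line_metric[OF inj] mdist_line_metric[OF inj]
    using K(1) inj by (intro conjI exI[of _ K] exI[of _ "0 :: real"]) auto
  then have "loxodromic G (line_metric \<iota>) (line_action \<iota> f) g"
    unfolding loxodromic_def by (auto simp: mspace_line_metric[OF inj])
  then show ?thesis
    unfolding property_NL_def
    using hyperbolic_space_line_metric[OF inj] isometric_action_line_action[OF inj G f] g by blast
qed

text \<open>If the image meets the translations only in the identity, it contains at most one reflection, since
  the product of two distinct reflections is a nontrivial translation.\<close>

lemma small_image_if_no_translation:
  fixes G (structure)
  assumes G: "group G" and f: "f \<in> hom G real_semidirect_Z2"
    and no: "\<And>g a. g \<in> carrier G \<Longrightarrow> f g = (a, 0) \<Longrightarrow> a = 0"
  shows "finite (f ` carrier G) \<and> card (f ` carrier G) \<le> 2"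
proof -
  interpret group G by (rule G)
  have cases: "f g = (0, 0) \<or> snd (f g) = 1" if "g \<in> carrier G" for g
    using no[OF that] hom_in_carrier[OF f that]
    by (cases "f g") (auto simp: carrier_real_semidirect_Z2)
  have "\<exists>b. f ` carrier G \<subseteq> {(0, 0), (b, 1)}"
  proof (cases "\<exists>t\<in>carrier G. snd (f t) = 1")
    case True
    then obtain t b where t: "t \<in> carrier G" "f t = (b, 1)"
      by (metis prod.collapse)
    have "f g = (b, 1)" if g: "g \<in> carrier G" "snd (f g) = 1" for g
    proof -
      have "f g = (fst (f g), 1)"
        using g(2) by (metis prod.collapse)
      then have "f (g \<otimes> t) = (fst (f g) - b, 0)"
        using hom_mult[OF f g(1) t(1)] t(2)
          mult_real_semidirect_Z2[of "fst (f g)" 1 b 1] by simp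
      then have "fst (f g) = b"
        using no[of "g \<otimes> t"] g t by fastforce
      then show ?thesis
        using g(2) by (metis prod.collapse)
    qed
    then show ?thesis
      using cases by blast
  next
    case False
    then show ?thesis
      using cases by blast
  qed
  then obtain b where sub: "f ` carrier G \<subseteq> {(0, 0), (b, 1)}"
    by blast
  show ?thesis
    using card_mono[OF _ sub] finite_subset[OF sub] by simp
qed

section \<open>Homomorphisms from abelian groups to the reals\<close>

context comm_group
begin

text \<open>Graphs of homomorphisms to the reals defined on a subgroup. In this form the union of a chain is
  again one, as Zorn's lemma requires, and single-valuedness reduces to a condition over the identity.\<close>

definition partial_real_hom :: "('a \<times> real) set \<Rightarrow> bool" where
  "partial_real_hom K \<longleftrightarrow> K \<subseteq> carrier G \<times> UNIV \<and> (\<one>, 0) \<in> K \<and>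
     (\<forall>x r y s. (x, r) \<in> K \<longrightarrow> (y, s) \<in> K \<longrightarrow> (x \<otimes> y, r + s) \<in> K) \<and>
     (\<forall>x r. (x, r) \<in> K \<longrightarrow> (inv x, - r) \<in> K) \<and>
     (\<forall>r. (\<one>, r) \<in> K \<longrightarrow> r = 0)"

lemma
  assumes "partial_real_hom K"
  shows partial_real_hom_carrier: "(x, r) \<in> K \<Longrightarrow> x \<in> carrier G"
    and partial_real_hom_one: "(\<one>, 0) \<in> K"
    and partial_real_hom_mult: "(x, r) \<in> K \<Longrightarrow> (y, s) \<in> K \<Longrightarrow> (x \<otimes> y, r + s) \<in> K"
    and partial_real_hom_inv: "(x, r) \<in> K \<Longrightarrow> (inv x, - r) \<in> K"
    and partial_real_hom_one_unique: "(\<one>, r) \<in> K \<Longrightarrow> r = 0"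
  using assms unfolding partial_real_hom_def by blast+

lemma partial_real_hom_unique:
  assumes K: "partial_real_hom K" and "(x, r) \<in> K" "(x, s) \<in> K"
  shows "r = s"
proof -
  have "(x \<otimes> inv x, r + - s) \<in> K"
    using assms by (intro partial_real_hom_mult partial_real_hom_inv)
  then show ?thesis
    using partial_real_hom_one_unique[OF K, of "r - s"] partial_real_hom_carrier[OF K assms(2)] by simp
qed

lemma partial_real_hom_int_pow:
  assumes K: "partial_real_hom K" and xr: "(x, r) \<in> K"
  shows "(x [^] (n :: int), n * r) \<in> K"
proof -
  have x: "x \<in> carrier G"
    by (rule partial_real_hom_carrier[OF K xr])
  have nat: "(x [^] k, k * r) \<in> K" for k :: nat
  proof (induction k)
    case (Suc k)
    then show ?case
      using partial_real_hom_mult[OF K Suc xr] by (simp add: algebra_simps)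
  qed (simp add: partial_real_hom_one[OF K])
  show ?thesis
    using nat partial_real_hom_inv[OF K nat] x
    by (cases n rule: int_cases2) (simp_all add: int_pow_int int_pow_neg_int)
qed

text \<open>The value \<open>c\<close> at the new element \<open>h\<close> has to be compatible with the powers of \<open>h\<close> on which the
  homomorphism is defined already. The divisibility of the reals provides such a value in
  \<open>exists_slope\<close>.\<close>

lemma partial_real_hom_extend:
  assumes K: "partial_real_hom K" and h: "h \<in> carrier G"
    and c: "\<And>n v. (h [^] (n :: int), v) \<in> K \<Longrightarrow> v = of_int n * c"
  obtains K' where "partial_real_hom K'" "K \<subseteq> K'" "(h, c) \<in> K'"
proof
  let ?K' = "{(h [^] (n :: int) \<otimes> x, of_int n * c + r) | n x r. (x, r) \<in> K}"
  note carr = partial_real_hom_carrier[OF K]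
  have memI: "(h [^] (n :: int) \<otimes> x, of_int n * c + r) \<in> ?K'" if "(x, r) \<in> K" for n x r
    using that by blast
  show "K \<subseteq> ?K'"
    using memI[where n = 0] carr by fastforce
  show "(h, c) \<in> ?K'"
    using memI[OF partial_real_hom_one[OF K], of 1] h by simp
  show "partial_real_hom ?K'"
    unfolding partial_real_hom_def
  proof (intro conjI allI impI)
    show "?K' \<subseteq> carrier G \<times> UNIV"
      using h carr by auto
    show "(\<one>, 0) \<in> ?K'"
      using memI[OF partial_real_hom_one[OF K], of 0] by simp
  next
    fix x r y s assume "(x, r) \<in> ?K'" "(y, s) \<in> ?K'"
    then obtain i x' r' j y' s' where
      x: "x = h [^] (i :: int) \<otimes> x'" "r = i * c + r'" "(x', r') \<in> K" and
      y: "y = h [^] (j :: int) \<otimes> y'" "s = j * c + s'" "(y', s') \<in> K"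
      by blast
    have "x \<otimes> y = h [^] (i + j) \<otimes> (x' \<otimes> y')"
      using h carr[OF x(3)] carr[OF y(3)] by (simp add: x y int_pow_mult m_ac)
    moreover have "r + s = of_int (i + j) * c + (r' + s')"
      by (simp add: x y algebra_simps)
    ultimately show "(x \<otimes> y, r + s) \<in> ?K'"
      using memI[OF partial_real_hom_mult[OF K x(3) y(3)], of "i + j"] by metis
  next
    fix x r assume "(x, r) \<in> ?K'"
    then obtain i x' r' where x: "x = h [^] (i :: int) \<otimes> x'" "r = i * c + r'" "(x', r') \<in> K"
      by blast
    have "inv x = h [^] (- i) \<otimes> inv x'"
      using h carr[OF x(3)] by (simp add: x inv_mult int_pow_neg)
    moreover have "- r = of_int (- i) * c + - r'"
      by (simp add: x)
    ultimately show "(inv x, - r) \<in> ?K'"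
      using memI[OF partial_real_hom_inv[OF K x(3)], of "- i"] by metis
  next
    fix r assume "(\<one>, r) \<in> ?K'"
    then obtain i x' r' where x: "\<one> = h [^] (i :: int) \<otimes> x'" "r = i * c + r'" "(x', r') \<in> K"
      by blast
    have "x' \<otimes> h [^] i = \<one>"
      using x(1) h carr[OF x(3)] by (simp add: m_comm)
    then have "x' = h [^] (- i)"
      using h carr[OF x(3)] inv_equality[of x' "h [^] i"] by (simp add: int_pow_neg)
    then have "r' = of_int (- i) * c"
      using c x(3) by blast
    then show "r = 0"
      by (simp add: x)
  qed
qed

text \<open>One power \<open>h\<^sup>n\<close> in the domain, \<open>n \<noteq> 0\<close>, determines \<open>c\<close>. Any other \<open>h\<^sup>k\<close> agrees with this choice
  because both determine the value at \<open>h\<^sup>n\<^sup>k\<close>.\<close>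

lemma exists_slope:
  assumes K: "partial_real_hom K" and h: "h \<in> carrier G"
  shows "\<exists>c. \<forall>n v. (h [^] (n :: int), v) \<in> K \<longrightarrow> v = of_int n * c"
proof (cases "\<exists>n v. n \<noteq> 0 \<and> (h [^] (n :: int), v) \<in> K")
  case True
  then obtain n v where n: "n \<noteq> 0" "(h [^] (n :: int), v) \<in> K"
    by blast
  have "w = k * (v / n)" if kw: "(h [^] (k :: int), w) \<in> K" for k w
  proof -
    have "(h [^] (n * k), k * v) \<in> K" "(h [^] (n * k), n * w) \<in> K"
      using partial_real_hom_int_pow[OF K n(2), of k] partial_real_hom_int_pow[OF K kw, of n] h
      by (simp_all add: int_pow_pow mult.commute)
    then have "k * v = n * w"
      by (rule partial_real_hom_unique[OF K])
    then show ?thesis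
      using n(1) by (simp add: field_simps)
  qed
  then show ?thesis
    by blast
next
  case False
  have "v = of_int n * 0" if nv: "(h [^] (n :: int), v) \<in> K" for n v
  proof -
    have "n = 0"
      using False nv by blast
    then show ?thesis
      using partial_real_hom_one_unique[OF K, of v] nv by simp
  qed
  then show ?thesis
    by blast
qed

lemma partial_real_hom_Union_chain:
  assumes "C \<noteq> {}" and chain: "subset.chain {K. partial_real_hom K \<and> p \<in> K} C"
  shows "partial_real_hom (\<Union>C) \<and> p \<in> \<Union>C"
proof -
  have mem: "partial_real_hom K" "p \<in> K" if "K \<in> C" for K
    using chain that unfolding subset.chain_def by auto
  obtain K0 where K0: "K0 \<in> C"
    using assms(1) by blast
  have common: "\<exists>K\<in>C. a \<in> K \<and> b \<in> K" if "a \<in> \<Union>C" "b \<in> \<Union>C" for a b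
    using that chain unfolding subset_chain_def by blast
  have "partial_real_hom (\<Union>C)"
    unfolding partial_real_hom_def
  proof (intro conjI allI impI)
    show "\<Union>C \<subseteq> carrier G \<times> UNIV"
      using mem(1) unfolding partial_real_hom_def by blast
    show "(\<one>, 0) \<in> \<Union>C"
      using K0 mem(1) partial_real_hom_one by blast
    show "(x \<otimes> y, r + s) \<in> \<Union>C" if "(x, r) \<in> \<Union>C" "(y, s) \<in> \<Union>C" for x r y s
      using common[OF that] mem(1) partial_real_hom_mult by blast
    show "(inv x, - r) \<in> \<Union>C" if "(x, r) \<in> \<Union>C" for x r
      using that mem(1) partial_real_hom_inv by blast
    show "r = 0" if "(\<one>, r) \<in> \<Union>C" for r
      using that mem(1) partial_real_hom_one_unique by blast
  qed
  then show ?thesis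
    using K0 mem(2) by blast
qed

text \<open>The homomorphism that sends \<open>g\<close> to 1 on the infinite cyclic group generated by \<open>g\<close> extends to the
  whole group because the reals are divisible, hence injective among abelian groups.\<close>

theorem exists_real_hom_if_infinite_order:
  assumes g: "g \<in> carrier G" and inf: "\<And>n :: nat. n > 0 \<Longrightarrow> g [^] n \<noteq> \<one>"
  shows "\<exists>f \<in> hom G real_group. f g = 1"
proof -
  have zero: "n = 0" if "g [^] n = \<one>" for n :: int
  proof (cases n rule: int_cases2)
    case (nonneg k)
    then show ?thesis
      using inf[of k] that by (auto simp: int_pow_int)
  next
    case (nonpos k)
    then have "inv (g [^] k) = \<one>"
      using that g by (simp add: int_pow_neg_int)
    then have "g [^] k = \<one>"
      using g inv_eq_1_iff nat_pow_closed by blast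
    then show ?thesis
      using inf[of k] nonpos by auto
  qed
  have "partial_real_hom {(\<one>, 0)}"
    by (simp add: partial_real_hom_def)
  then obtain K0 where "partial_real_hom K0" "(g, 1) \<in> K0"
    using partial_real_hom_extend[of "{(\<one>, 0)}" g 1] g zero by (metis Pair_inject mult_zero_left of_int_0 singletonD)
  then have ne: "{K. partial_real_hom K \<and> (g, 1) \<in> K} \<noteq> {}"
    by blast
  have "\<exists>M\<in>{K. partial_real_hom K \<and> (g, 1) \<in> K}. \<forall>X\<in>{K. partial_real_hom K \<and> (g, 1) \<in> K}.
      M \<subseteq> X \<longrightarrow> X = M"
    by (rule subset_Zorn_nonempty[OF ne]) (use partial_real_hom_Union_chain in blast)
  then obtain M where M: "partial_real_hom M" "(g, 1) \<in> M"
    and max: "\<And>X. partial_real_hom X \<Longrightarrow> (g, 1) \<in> X \<Longrightarrow> M \<subseteq> X \<Longrightarrow> X = M"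
    by blast
  have "\<exists>r. (h, r) \<in> M" if h: "h \<in> carrier G" for h
  proof -
    obtain c where "\<And>n v. (h [^] (n :: int), v) \<in> M \<Longrightarrow> v = of_int n * c"
      using exists_slope[OF M(1) h] by blast
    then obtain M' where "partial_real_hom M'" "M \<subseteq> M'" "(h, c) \<in> M'"
      using partial_real_hom_extend[OF M(1) h] by blast
    then show ?thesis
      using max[of M'] M(2) by blast
  qed
  then obtain f where f: "\<And>h. h \<in> carrier G \<Longrightarrow> (h, f h) \<in> M"
    by metis
  have "f \<in> hom G real_group"
  proof (rule homI)
    fix h k assume "h \<in> carrier G" "k \<in> carrier G"
    then show "f (h \<otimes> k) = f h \<otimes>\<^bsub>real_group\<^esub> f k"
      using partial_real_hom_unique[OF M(1) f partial_real_hom_mult[OF M(1) f f]]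
      by (simp add: real_group_def)
  qed (simp add: real_group_def)
  moreover have "f g = 1"
    using partial_real_hom_unique[OF M(1) f[OF g] M(2)] .
  ultimately show ?thesis
    by blast
qed

end

section \<open>Nilpotent groups with torsion abelianization\<close>

context group
begin

lemma lower_central_series_normal: "lower_central_series G n \<lhd> G"
proof (induction n)
  case 0
  show ?case
    by (simp add: normal_inv_iff subgroup_self)
next
  case (Suc n)
  let ?S = "\<Union>x\<in>lower_central_series G n. \<Union>y\<in>carrier G. {x \<otimes> y \<otimes> inv x \<otimes> inv y}"
  interpret N: normal "lower_central_series G n" G
    by (rule Suc)
  show ?case
    unfolding lower_central_series.simps
  proof (rule normal_generateI)
    show "?S \<subseteq> carrier G"
      using N.subset by auto
    fix c g assume "c \<in> ?S" and g: "g \<in> carrier G"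
    then obtain x y where x: "x \<in> lower_central_series G n" and y: "y \<in> carrier G"
      and c: "c = x \<otimes> y \<otimes> inv x \<otimes> inv y"
      by blast
    have xG: "x \<in> carrier G"
      using x N.subset by blast
    have "g \<otimes> c \<otimes> inv g = (g \<otimes> x \<otimes> inv g) \<otimes> (g \<otimes> y \<otimes> inv g) \<otimes> inv (g \<otimes> x \<otimes> inv g) \<otimes> inv (g \<otimes> y \<otimes> inv g)"
      using g xG y by (simp add: c m_assoc inv_mult_group) (simp add: m_assoc[symmetric])
    moreover have "g \<otimes> x \<otimes> inv g \<in> lower_central_series G n"
      using N.inv_op_closed2[OF g x] .
    ultimately show "g \<otimes> c \<otimes> inv g \<in> ?S"
      using g y by blast
  qed
qed

lemma commutator_in_lower_central_series:
  assumes "x \<in> lower_central_series G n" "y \<in> carrier G"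
  shows "x \<otimes> y \<otimes> inv x \<otimes> inv y \<in> lower_central_series G (Suc n)"
  using assms by (auto intro: generate.incl)

text \<open>If the commutator \<open>C\<close> of \<open>X\<close> and \<open>Y\<close> commutes with \<open>X\<close>, then moving \<open>Y\<close> past \<open>X\<^sup>j\<close> produces \<open>C\<^sup>j\<close>.\<close>

lemma central_commutator_pow:
  assumes "X \<in> carrier G" "Y \<in> carrier G" "C \<in> carrier G"
    and comm: "C \<otimes> X = X \<otimes> C" and XY: "X \<otimes> Y = C \<otimes> (Y \<otimes> X)"
  shows "X [^] (j :: nat) \<otimes> Y = C [^] j \<otimes> (Y \<otimes> X [^] j)"
proof (induction j)
  case (Suc j)
  have "C \<otimes> X [^] j = X [^] j \<otimes> C"
    using group_commutes_pow[of X C j] comm assms by simp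
  then have "X [^] Suc j \<otimes> Y = C \<otimes> (X [^] j \<otimes> Y) \<otimes> X"
    using assms(1-3) by (simp add: m_assoc XY) (simp add: m_assoc[symmetric])
  also have "\<dots> = C \<otimes> C [^] j \<otimes> (Y \<otimes> X [^] Suc j)"
    using assms(1-3) by (simp add: Suc m_assoc)
  finally show ?case
    using assms(3) by (simp add: nat_pow_comm[of C 1 j, simplified])
qed (use assms in simp)

text \<open>Modulo the term after next, each commutator \<open>[a, b]\<close> with \<open>a\<close> in the \<open>n\<close>-th term of the lower central
  series is central, so its \<open>k\<close>-th power is \<open>[a\<^sup>k, b]\<close>. If \<open>a\<^sup>k\<close> lies in the next term, this is
  trivial. Hence the next quotient is abelian and generated by elements of finite order.\<close>

lemma lower_central_quotient_torsion:
  assumes ab: "\<And>x. x \<in> carrier G \<Longrightarrow> \<exists>k>0. x [^] (k :: nat) \<in> lower_central_series G 1"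
    and x: "x \<in> lower_central_series G n"
  shows "\<exists>k>0. x [^] (k :: nat) \<in> lower_central_series G (Suc n)"
  using x
proof (induction n arbitrary: x)
  case 0
  then show ?case
    using ab by simp
next
  case (Suc n)
  define L where "L = lower_central_series G"
  have L_normal: "L k \<lhd> G" for k
    by (simp only: L_def lower_central_series_normal)
  have L_commutator: "a \<otimes> b \<otimes> inv a \<otimes> inv b \<in> L (Suc k)" if "a \<in> L k" "b \<in> carrier G" for a b k
    using commutator_in_lower_central_series that unfolding L_def by blast
  have L_Suc: "L (Suc n) = generate G (\<Union>x\<in>L n. \<Union>y\<in>carrier G. {x \<otimes> y \<otimes> inv x \<otimes> inv y})"
    by (simp add: L_def)
  have IH: "\<exists>k>0. a [^] (k :: nat) \<in> L (Suc n)" if "a \<in> L n" for a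
    using Suc.IH that unfolding L_def by blast
  have xL: "x \<in> L (Suc n)"
    using Suc.prems unfolding L_def .
  interpret N: normal "L (Suc (Suc n))" G
    by (rule L_normal)
  interpret L1: normal "L (Suc n)" G
    by (rule L_normal)
  interpret L0: normal "L n" G
    by (rule L_normal)
  let ?Q = "G Mod L (Suc (Suc n))"
  define \<pi> where "\<pi> = (\<lambda>a. L (Suc (Suc n)) #> a)"
  note [simp del] = mult_FactGroup one_FactGroup
  interpret Q: group ?Q
    by (rule N.factorgroup_is_group)
  interpret \<pi>: group_hom G ?Q \<pi>
    using N.r_coset_hom_Mod by (simp add: group_hom_def group_hom_axioms_def \<pi>_def)
  have kernel: "\<pi> a = \<one>\<^bsub>?Q\<^esub> \<longleftrightarrow> a \<in> L (Suc (Suc n))" if "a \<in> carrier G" for a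
    using that coset_join1[OF _ that N.is_subgroup] N.rcos_const
    by (auto simp: \<pi>_def one_FactGroup)
  have central: "\<pi> z \<otimes>\<^bsub>?Q\<^esub> \<pi> y = \<pi> y \<otimes>\<^bsub>?Q\<^esub> \<pi> z"
    if z: "z \<in> L (Suc n)" and y: "y \<in> carrier G" for z y
  proof -
    have zG: "z \<in> carrier G"
      using z L1.subset by blast
    have "\<pi> (z \<otimes> y \<otimes> inv z \<otimes> inv y) = \<one>\<^bsub>?Q\<^esub>"
      by (rule iffD2[OF kernel L_commutator[OF z y]]) (use zG y in simp)
    then have "\<pi> z \<otimes>\<^bsub>?Q\<^esub> \<pi> y \<otimes>\<^bsub>?Q\<^esub> inv\<^bsub>?Q\<^esub> (\<pi> y \<otimes>\<^bsub>?Q\<^esub> \<pi> z) = \<one>\<^bsub>?Q\<^esub>"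
      using zG y by (simp add: Q.inv_mult_group Q.m_assoc)
    then show ?thesis
      using zG y Q.inv_solve_right[of "\<one>\<^bsub>?Q\<^esub>" "\<pi> z \<otimes>\<^bsub>?Q\<^esub> \<pi> y" "\<pi> y \<otimes>\<^bsub>?Q\<^esub> \<pi> z"]
      by simp
  qed
  have generators: "\<exists>k>0. \<pi> (a \<otimes> b \<otimes> inv a \<otimes> inv b) [^]\<^bsub>?Q\<^esub> (k :: nat) = \<one>\<^bsub>?Q\<^esub>"
    if a: "a \<in> L n" and b: "b \<in> carrier G" for a b
  proof -
    have aG: "a \<in> carrier G"
      using a L0.subset by blast
    obtain k where k: "k > 0" "a [^] (k :: nat) \<in> L (Suc n)"
      using IH[OF a] by blast
    define c where "c = a \<otimes> b \<otimes> inv a \<otimes> inv b"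
    have c: "c \<in> L (Suc n)" "c \<in> carrier G"
      using L_commutator[OF a b] aG b by (auto simp: c_def)
    have "c = (a \<otimes> b) \<otimes> inv (b \<otimes> a)"
      using aG b by (simp add: c_def m_assoc inv_mult_group)
    then have "a \<otimes> b = c \<otimes> (b \<otimes> a)"
      using inv_solve_right[of c "a \<otimes> b" "b \<otimes> a"] aG b c by simp
    then have "\<pi> a \<otimes>\<^bsub>?Q\<^esub> \<pi> b = \<pi> c \<otimes>\<^bsub>?Q\<^esub> (\<pi> b \<otimes>\<^bsub>?Q\<^esub> \<pi> a)"
      using aG b c by (metis \<pi>.hom_mult m_closed)
    then have "\<pi> a [^]\<^bsub>?Q\<^esub> k \<otimes>\<^bsub>?Q\<^esub> \<pi> b = \<pi> c [^]\<^bsub>?Q\<^esub> k \<otimes>\<^bsub>?Q\<^esub> (\<pi> b \<otimes>\<^bsub>?Q\<^esub> \<pi> a [^]\<^bsub>?Q\<^esub> k)"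
      using aG b c central[OF c(1) aG] by (intro Q.central_commutator_pow) auto
    moreover have "\<pi> a [^]\<^bsub>?Q\<^esub> k \<otimes>\<^bsub>?Q\<^esub> \<pi> b = \<pi> b \<otimes>\<^bsub>?Q\<^esub> \<pi> a [^]\<^bsub>?Q\<^esub> k"
      using central[OF k(2) b] aG by (simp add: \<pi>.hom_nat_pow)
    ultimately have "\<pi> c [^]\<^bsub>?Q\<^esub> k = \<one>\<^bsub>?Q\<^esub>"
      using Q.r_cancel_one'[of "\<pi> b \<otimes>\<^bsub>?Q\<^esub> \<pi> a [^]\<^bsub>?Q\<^esub> k" "\<pi> c [^]\<^bsub>?Q\<^esub> k"] aG b c
      by (metis Q.m_closed Q.nat_pow_closed \<pi>.hom_closed)
    then show ?thesis
      using k(1) by (auto simp: c_def)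
  qed
  have all: "\<exists>k>0. \<pi> z [^]\<^bsub>?Q\<^esub> (k :: nat) = \<one>\<^bsub>?Q\<^esub>"
    if "z \<in> generate G (\<Union>x\<in>L n. \<Union>y\<in>carrier G. {x \<otimes> y \<otimes> inv x \<otimes> inv y})" for z
    using that
  proof (induction rule: generate.induct)
    case one
    show ?case
      by (intro exI[of _ 1]) simp
  next
    case (incl h)
    then show ?case
      using generators by blast
  next
    case (inv h)
    then obtain a b where ab: "a \<in> L n" "b \<in> carrier G" "h = a \<otimes> b \<otimes> inv a \<otimes> inv b"
      by blast
    then have "h \<in> carrier G"
      using L0.subset by auto
    then show ?case
      using generators[OF ab(1,2)] ab(3) by (auto simp: Q.nat_pow_inv)
  next
    case (eng h1 h2)
    then obtain k l where kl: "k > 0" "\<pi> h1 [^]\<^bsub>?Q\<^esub> (k :: nat) = \<one>\<^bsub>?Q\<^esub>"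
        "l > 0" "\<pi> h2 [^]\<^bsub>?Q\<^esub> (l :: nat) = \<one>\<^bsub>?Q\<^esub>"
      by blast
    have h: "h1 \<in> L (Suc n)" "h2 \<in> L (Suc n)"
      using eng.hyps unfolding L_Suc by blast+
    then have hG: "h1 \<in> carrier G" "h2 \<in> carrier G"
      using L1.subset by blast+
    have "\<pi> (h1 \<otimes> h2) [^]\<^bsub>?Q\<^esub> (k * l) = \<pi> h1 [^]\<^bsub>?Q\<^esub> (k * l) \<otimes>\<^bsub>?Q\<^esub> \<pi> h2 [^]\<^bsub>?Q\<^esub> (k * l)"
      using hG Q.pow_mult_distrib[OF central[OF h(1) hG(2)], of "k * l"] by simp
    also have "\<pi> h1 [^]\<^bsub>?Q\<^esub> (k * l) = \<one>\<^bsub>?Q\<^esub>"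
      using kl hG Q.nat_pow_pow[of "\<pi> h1" k l] by simp
    also have "\<pi> h2 [^]\<^bsub>?Q\<^esub> (k * l) = \<one>\<^bsub>?Q\<^esub>"
      using kl hG Q.nat_pow_pow[of "\<pi> h2" l k] by (simp add: mult.commute)
    finally have "\<pi> (h1 \<otimes> h2) [^]\<^bsub>?Q\<^esub> (k * l) = \<one>\<^bsub>?Q\<^esub>"
      by simp
    then show ?case
      using kl by (intro exI[of _ "k * l"]) simp
  qed
  then obtain k where k: "k > 0" "\<pi> x [^]\<^bsub>?Q\<^esub> (k :: nat) = \<one>\<^bsub>?Q\<^esub>"
    using all xL unfolding L_Suc by blast
  have "x \<in> carrier G"
    using xL L1.subset by blast
  then have "x [^] k \<in> L (Suc (Suc n))"
    using k kernel[of "x [^] k"] by (simp add: \<pi>.hom_nat_pow)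
  then show ?case
    using k(1) unfolding L_def by blast
qed

lemma nilpotent_torsion:
  assumes nil: "nilpotent_group G"
    and ab: "\<And>x. x \<in> carrier G \<Longrightarrow> \<exists>k>0. x [^] (k :: nat) \<in> lower_central_series G 1"
  shows "torsion_group G"
proof -
  have "\<exists>k>0. x [^] (k :: nat) \<in> lower_central_series G n" if x: "x \<in> carrier G" for x n
  proof (induction n)
    case 0
    show ?case
      using x by (intro exI[of _ 1]) simp
  next
    case (Suc n)
    then obtain k where k: "k > 0" "x [^] (k :: nat) \<in> lower_central_series G n"
      by blast
    then obtain l where "l > 0" "(x [^] k) [^] (l :: nat) \<in> lower_central_series G (Suc n)"
      using lower_central_quotient_torsion[OF ab] by blast
    then show ?case
      using k x by (intro exI[of _ "k * l"]) (simp add: nat_pow_pow)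
  qed
  moreover obtain n where "lower_central_series G n = {\<one>}"
    using nil by (auto simp: nilpotent_group_def)
  ultimately show ?thesis
    unfolding torsion_group_def using is_group by blast
qed

text \<open>An element of infinite order in the abelianization would be detected by a homomorphism to the reals.\<close>

lemma abelianization_torsion:
  assumes triv: "\<forall>f \<in> hom G real_group. \<forall>g \<in> carrier G. f g = \<one>\<^bsub>real_group\<^esub>"
    and x: "x \<in> carrier G"
  shows "\<exists>k>0. x [^] (k :: nat) \<in> lower_central_series G 1"
proof (rule ccontr)
  assume no: "\<not> ?thesis"
  let ?D = "derived G (carrier G)"
  have D: "lower_central_series G 1 = ?D"
    by (simp add: derived_def)
  interpret N: normal ?D G
    using derived_self_is_normal .
  interpret Q: comm_group "G Mod ?D"
    by (rule derived_quot_is_comm_group)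
  have hom: "(\<lambda>a. ?D #> a) \<in> hom G (G Mod ?D)"
    by (rule N.r_coset_hom_Mod)
  have "(?D #> x) [^]\<^bsub>G Mod ?D\<^esub> k \<noteq> \<one>\<^bsub>G Mod ?D\<^esub>" if "k > 0" for k :: nat
  proof
    assume "(?D #> x) [^]\<^bsub>G Mod ?D\<^esub> k = \<one>\<^bsub>G Mod ?D\<^esub>"
    then have "?D #> (x [^] k) = ?D"
      using N.FactGroup_pow x by (simp add: FactGroup_def)
    then have "x [^] k \<in> ?D"
      using coset_join1[OF _ _ N.is_subgroup] x by simp
    then show False
      using no that unfolding D by blast
  qed
  then obtain f where f: "f \<in> hom (G Mod ?D) real_group" "f (?D #> x) = 1"
    using Q.exists_real_hom_if_infinite_order hom_in_carrier[OF hom x] by blast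
  have "f \<circ> (\<lambda>a. ?D #> a) \<in> hom G real_group"
    by (rule Group.hom_compose[OF hom f(1)])
  then show False
    using triv x f(2) by (auto simp: real_group_def)
qed

end

section \<open>Property (NL)\<close>

text \<open>A loxodromic element has infinite order, since its orbit is unbounded.\<close>

lemma torsion_imp_property_NL:
  assumes "torsion_group G"
  shows "property_NL TYPE('x) G"
  unfolding property_NL_def
proof safe
  fix X :: "'x metric" and \<phi> g
  assume g: "g \<in> carrier G" and lox: "loxodromic G X \<phi> g"
  interpret group G
    using assms by (simp add: torsion_group_def)
  obtain k :: nat where k: "k > 0" "g [^]\<^bsub>G\<^esub> k = \<one>\<^bsub>G\<^esub>"
    using assms g by (auto simp: torsion_group_def)
  obtain x K C where x: "x \<in> mspace X" and K: "K \<ge> 1" and low: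
    "\<forall>i\<in>mspace integer_metric. \<forall>j\<in>mspace integer_metric.
      mdist integer_metric i j / K - C \<le> mdist X (\<phi> (g [^]\<^bsub>G\<^esub> i) x) (\<phi> (g [^]\<^bsub>G\<^esub> j) x) \<and>
      mdist X (\<phi> (g [^]\<^bsub>G\<^esub> i) x) (\<phi> (g [^]\<^bsub>G\<^esub> j) x) \<le> K * mdist integer_metric i j + C"
    and img: "(\<lambda>n :: int. \<phi> (g [^]\<^bsub>G\<^esub> n) x) ` mspace integer_metric \<subseteq> mspace X"
    using lox unfolding loxodromic_def quasi_isometric_embedding_def by blast
  obtain N :: nat where N: "K * C < N"
    using reals_Archimedean2 by blast
  have "g [^]\<^bsub>G\<^esub> int (k * N) = \<one>\<^bsub>G\<^esub>"
    unfolding int_pow_int using nat_pow_pow[OF g, of k N] k by simp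
  moreover have "\<phi> \<one>\<^bsub>G\<^esub> x \<in> mspace X"
    using img by (metis UNIV_I image_subset_iff int_pow_0 mspace_integer_metric)
  then have "mdist X (\<phi> \<one>\<^bsub>G\<^esub> x) (\<phi> \<one>\<^bsub>G\<^esub> x) = 0"
    by simp
  moreover have "mdist integer_metric (int (k * N)) 0 / K - C \<le>
      mdist X (\<phi> (g [^]\<^bsub>G\<^esub> int (k * N)) x) (\<phi> (g [^]\<^bsub>G\<^esub> (0 :: int)) x)"
    using low by (simp only: mspace_integer_metric) blast
  ultimately have "real (k * N) / K \<le> C"
    by simp
  then have "k * N \<le> K * C"
    using K by (simp add: field_simps)
  moreover have "real N \<le> real (k * N)"
    using k(1) by (intro of_nat_mono) simp
  ultimately show False
    using N by simp
qed

lemma embed_real_hom: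
  assumes "f \<in> hom G real_group"
  shows "(\<lambda>g. (f g, 0)) \<in> hom G real_semidirect_Z2"
  using assms
  by (auto simp: hom_def real_group_def mult_real_semidirect_Z2 carrier_real_semidirect_Z2)

lemma real_hom_trivial_if_property_NL:
  fixes \<iota> :: "real \<Rightarrow> 'x"
  assumes "inj \<iota>" "group G" "property_NL TYPE('x) G"
    and f: "f \<in> hom G real_group" and g: "g \<in> carrier G"
  shows "f g = \<one>\<^bsub>real_group\<^esub>"
proof (rule ccontr)
  assume "f g \<noteq> \<one>\<^bsub>real_group\<^esub>"
  then show False
    using not_property_NL_if_translation[OF assms(1,2) embed_real_hom[OF f] g, of "f g"] assms(3)
    by (simp add: real_group_def)
qed

theorem theorem1p4:
  fixes G :: "('g, 'm) monoid_scheme"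
  assumes "\<exists>\<iota> :: real \<Rightarrow> 'x. inj \<iota>"
  shows "(amenable_group G \<longrightarrow>
            (property_NL TYPE('x) G \<longleftrightarrow>
             (\<forall>f \<in> hom G real_semidirect_Z2. finite (f ` carrier G) \<and> card (f ` carrier G) \<le> 2)))
       \<and> (comm_group G \<longrightarrow> (property_NL TYPE('x) G \<longleftrightarrow> torsion_group G))
       \<and> (nilpotent_group G \<longrightarrow>
            (property_NL TYPE('x) G \<longleftrightarrow>
             (\<forall>f \<in> hom G real_group. \<forall>g \<in> carrier G. f g = \<one>\<^bsub>real_group\<^esub>)))"
proof (intro conjI impI)
  obtain \<iota> :: "real \<Rightarrow> 'x" where \<iota>: "inj \<iota>"
    using assms by blast
  show "property_NL TYPE('x) G \<longleftrightarrow>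
      (\<forall>f \<in> hom G real_semidirect_Z2. finite (f ` carrier G) \<and> card (f ` carrier G) \<le> 2)"
    if am: "amenable_group G"
  proof
    assume NL: "property_NL TYPE('x) G"
    have G: "group G"
      using am by (simp add: amenable_group_def)
    show "\<forall>f \<in> hom G real_semidirect_Z2. finite (f ` carrier G) \<and> card (f ` carrier G) \<le> 2"
    proof
      fix f assume f: "f \<in> hom G real_semidirect_Z2"
      show "finite (f ` carrier G) \<and> card (f ` carrier G) \<le> 2"
      proof (rule small_image_if_no_translation[OF G f])
        show "a = 0" if "g \<in> carrier G" "f g = (a, 0)" for g a
          using not_property_NL_if_translation[OF \<iota> G f that] NL by blast
      qed
    qed
  next
    assume small: "\<forall>f \<in> hom G real_semidirect_Z2. finite (f ` carrier G) \<and> card (f ` carrier G) \<le> 2"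
    show "property_NL TYPE('x) G"
      unfolding property_NL_def hyperbolic_space_def
    proof safe
      fix X :: "'x metric" and \<phi> g
      assume "gromov_hyperbolic X" "isometric_action G X \<phi>" "g \<in> carrier G" "loxodromic G X \<phi> g"
      then show False
        using amenable_loxodromic_imp_large_image[OF am] small by meson
    qed
  qed
  show "property_NL TYPE('x) G \<longleftrightarrow> torsion_group G" if ab: "comm_group G"
  proof
    interpret comm_group G by (rule ab)
    assume NL: "property_NL TYPE('x) G"
    show "torsion_group G"
    proof (rule ccontr)
      assume "\<not> torsion_group G"
      then obtain g where g: "g \<in> carrier G" "\<And>n :: nat. n > 0 \<Longrightarrow> g [^]\<^bsub>G\<^esub> n \<noteq> \<one>\<^bsub>G\<^esub>"
        unfolding torsion_group_def using is_group by blast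
      obtain f where f: "f \<in> hom G real_group" "f g = 1"
        using exists_real_hom_if_infinite_order[OF g] by blast
      then show False
        using real_hom_trivial_if_property_NL[OF \<iota> is_group NL f(1) g(1)]
        by (simp add: real_group_def)
    qed
  qed (rule torsion_imp_property_NL)
  show "property_NL TYPE('x) G \<longleftrightarrow>
      (\<forall>f \<in> hom G real_group. \<forall>g \<in> carrier G. f g = \<one>\<^bsub>real_group\<^esub>)"
    if nil: "nilpotent_group G"
  proof
    interpret group G
      using nil by (simp add: nilpotent_group_def)
    show "\<forall>f \<in> hom G real_group. \<forall>g \<in> carrier G. f g = \<one>\<^bsub>real_group\<^esub>"
      if "property_NL TYPE('x) G"
      using real_hom_trivial_if_property_NL[OF \<iota> is_group that] by blast
    assume "\<forall>f \<in> hom G real_group. \<forall>g \<in> carrier G. f g = \<one>\<^bsub>real_group\<^esub>"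
    then have "torsion_group G"
      using nilpotent_torsion[OF nil abelianization_torsion] by blast
    then show "property_NL TYPE('x) G"
      by (rule torsion_imp_property_NL)
  qed
qed

end
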